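(* Let $n\ge1$ and let $c_0,\dots,c_n$ be nonzero complex numbers with $\sigma=c_0+\dots+c_n\neq0$. Then the $\vee$-system $$A_n(c)=\{\sqrt{c_ic_j}\,(e_i-e_j):\ 0\le i<j\le n\}$$ is harmonic, with parameters $\kappa=1,2,\dots,n$ and with the potentials of the corresponding polynomial solutions given by the Pochhammer type integrals $$F_\kappa(x_0,\dots,x_n)=\frac1{2\pi i}\int_\gamma\prod_{j=0}^n(x-x_j)^{\lambda_j}\,dx,\qquad \kappa=1,2,\dots,n,$$ where $\lambda_j=\kappa\frac{c_j}{\sigma}$ and the contour $\gamma$ is a large circle surrounding all $x_0,\dots,x_n$.
   Context: **$\vee$-systems.** Let $V$ be a finite-dimensional complex vector space. A finite set $\mathcal A\subset V^*$ of pairwise non-collinear covectors spanning $V^*$, with canonical form $G_{\mathcal A}(x,y)=\sum_{\alpha\in\mathcal A}\alpha(x)\alpha(y)$ non-degenerate, is a $\vee$-system if, with $\alpha^\vee\in V$ defined by $G_{\mathcal A}(\alpha^\vee,x)=\alpha(x)$, for every $\alpha\in\mathcal A$ and every two-dimensional subspace $\Pi\subset V^*$ containing $\alpha$ one has $\sum_{\beta\in\Pi\cap\mathcal A}\beta(\alpha^\vee)\beta^\vee=\nu\alpha^\vee$ for some $\nu\in\mathbb C$. **Harmonic $\vee$-systems.** For $\kappa\in\mathbb C$ consider the system $$( * )_\kappa\qquad \partial_\xi\psi(x)=\kappa\sum_{\alpha\in\mathcal A}\frac{\alpha(\xi)\,\alpha(\psi(x))}{\alpha(x)}\,\alpha^\vee,\qquad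 \xi\in V,\ x\in V\setminus\bigcup_{\alpha\in\mathcal A}\{\alpha=0\},$$ for a vector field $\psi$. A $\vee$-system of rank $n=\dim V$ is harmonic if there are nonzero $\kappa_1,\dots,\kappa_n$ and polynomial vector fields $\psi^{(1)},\dots,\psi^{(n)}$, linearly independent at a generic point, such that $\psi^{(i)}$ solves $( * )_{\kappa_i}$ and $\kappa_1+\dots+\kappa_n=|\mathcal A|$. The potential of a polynomial solution $\psi$ is a polynomial $F$ on $V$ with $\partial_\eta F=G_{\mathcal A}(\psi,\eta)$ for all $\eta\in V$; it satisfies $\partial_\xi\partial_\eta F=\kappa\sum_{\alpha\in\mathcal A}\frac{\alpha(\xi)\alpha(\eta)}{\alpha(x)}\partial_{\alpha^\vee}F$. **The system $A_n(c)$.** The $e_i$ are the coordinate covectors $x_0,\dots,x_n$ on $\mathbb C^{n+1}$; $A_n(c)$ is regarded as a system of covectors on the $n$-dimensional space $V=\mathbb C^{n+1}/\mathbb C(1,\dots,1)$ (equivalently, on the hyperplane $\sum_i c_ix_i=0$), and functions on $V$ are translation-invariant functions of $x_0,\dots,x_n$. That $A_n(c)$ is a $\vee$-system is known. **The integrals.** For $\gamma$ a counterclockwise circle of large radius, the integrand is the single-valued function $x^\kappa\prod_{j=0}^n(1-x_j/x)^{\lambda_j}$ (principal branches; note $\sum_j\lambda_j=\kappa$), so $F_\kappa$ is the coefficient of $x^{-1}$ in its expansion at infinity. *)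

theory Defs
  imports "HOL-Complex_Analysis.Contour_Integration" "HOL-Library.Function_Algebras"
begin

class complex_vector = ab_group_add +
  fixes scaleC :: "complex \<Rightarrow> 'a \<Rightarrow> 'a" (infixr "*\<^sub>C" 75)
  assumes scaleC_add_right: "a *\<^sub>C (x + y) = a *\<^sub>C x + a *\<^sub>C y"
    and scaleC_add_left: "(a + b) *\<^sub>C x = a *\<^sub>C x + b *\<^sub>C x"
    and scaleC_scaleC: "a *\<^sub>C b *\<^sub>C x = (a * b) *\<^sub>C x"
    and scaleC_one: "1 *\<^sub>C x = x"

global_interpretation cvs: vector_space "scaleC :: complex \<Rightarrow> 'v \<Rightarrow> 'v :: complex_vector"
  defines cspan = cvs.span and cdim = cvs.dim and cindependent = cvs.independent
  by unfold_locales (simp_all add: scaleC_add_right scaleC_add_left scaleC_scaleC scaleC_one)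

class fin_dim_complex_vector = complex_vector +
  assumes finitely_generated: "\<exists>B. finite B \<and> (\<forall>v. \<exists>a. v = (\<Sum>b\<in>B. a b *\<^sub>C b))"

definition covector :: "('v::complex_vector \<Rightarrow> complex) \<Rightarrow> bool" where
  "covector \<alpha> \<longleftrightarrow> Vector_Spaces.linear (*\<^sub>C) (*) \<alpha>"

definition scale_fun :: "complex \<Rightarrow> ('v \<Rightarrow> complex) \<Rightarrow> 'v \<Rightarrow> complex" where
  "scale_fun a f = (\<lambda>x. a * f x)"

text \<open>
  The dual space is \<^term>\<open>Collect covector\<close>, a subspace of the space of all functions
  to \<^typ>\<open>complex\<close>.
\<close>

global_interpretation dual: vector_space "scale_fun :: complex \<Rightarrow> ('v \<Rightarrow> complex) \<Rightarrow> 'v \<Rightarrow> complex"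
  defines dual_span = dual.span and dual_dim = dual.dim
    and dual_independent = dual.independent and dual_subspace = dual.subspace
  by unfold_locales (simp_all add: scale_fun_def fun_eq_iff algebra_simps)

definition canonical_form :: "('v \<Rightarrow> complex) set \<Rightarrow> 'v \<Rightarrow> 'v \<Rightarrow> complex" where
  "canonical_form A x y = (\<Sum>\<alpha>\<in>A. \<alpha> x * \<alpha> y)"

definition nondegenerate :: "('v::zero \<Rightarrow> 'v \<Rightarrow> complex) \<Rightarrow> bool" where
  "nondegenerate G \<longleftrightarrow> (\<forall>x. (\<forall>y. G x y = 0) \<longrightarrow> x = 0)"

definition vee :: "('v \<Rightarrow> complex) set \<Rightarrow> ('v \<Rightarrow> complex) \<Rightarrow> 'v" where
  "vee A \<alpha> = (THE v. \<forall>x. canonical_form A v x = \<alpha> x)"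

definition vee_system :: "('v::fin_dim_complex_vector \<Rightarrow> complex) set \<Rightarrow> bool" where
  "vee_system A \<longleftrightarrow>
     finite A \<and> A \<subseteq> Collect covector \<and>
     (\<forall>\<alpha>\<in>A. \<forall>\<beta>\<in>A. \<alpha> \<noteq> \<beta> \<longrightarrow> dual_independent {\<alpha>, \<beta>}) \<and>
     dual_span A = Collect covector \<and>
     nondegenerate (canonical_form A) \<and>
     (\<forall>\<alpha>\<in>A. \<forall>P. dual_subspace P \<and> P \<subseteq> Collect covector \<and> dual_dim P = 2 \<and> \<alpha> \<in> P \<longrightarrow>
        (\<exists>\<nu>. (\<Sum>\<beta>\<in>P \<inter> A. \<beta> (vee A \<alpha>) *\<^sub>C vee A \<beta>) = \<nu> *\<^sub>C vee A \<alpha>))"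

inductive polynomial_fun :: "('v::complex_vector \<Rightarrow> complex) \<Rightarrow> bool" where
  const: "polynomial_fun (\<lambda>x. a)"
| covector: "covector \<alpha> \<Longrightarrow> polynomial_fun \<alpha>"
| add: "polynomial_fun p \<Longrightarrow> polynomial_fun q \<Longrightarrow> polynomial_fun (\<lambda>x. p x + q x)"
| mult: "polynomial_fun p \<Longrightarrow> polynomial_fun q \<Longrightarrow> polynomial_fun (\<lambda>x. p x * q x)"

definition polynomial_vector_field :: "('v::complex_vector \<Rightarrow> 'v) \<Rightarrow> bool" where
  "polynomial_vector_field \<psi> \<longleftrightarrow> (\<forall>\<phi>. covector \<phi> \<longrightarrow> polynomial_fun (\<lambda>x. \<phi> (\<psi> x)))"

definition has_dir_deriv ::
    "('v::complex_vector \<Rightarrow> complex) \<Rightarrow> complex \<Rightarrow> 'v \<Rightarrow> 'v \<Rightarrow> bool" where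
  "has_dir_deriv f d \<xi> x \<longleftrightarrow> ((\<lambda>t. f (x + t *\<^sub>C \<xi>)) has_field_derivative d) (at 0)"

text \<open>
  The derivative of a vector field is taken componentwise: the space carries no topology of its
  own, and in finite dimension convergence means convergence of all covectors.
\<close>

definition has_dir_deriv_field ::
    "('v::fin_dim_complex_vector \<Rightarrow> 'v) \<Rightarrow> 'v \<Rightarrow> 'v \<Rightarrow> 'v \<Rightarrow> bool" where
  "has_dir_deriv_field \<psi> d \<xi> x \<longleftrightarrow>
     (\<forall>\<phi>. covector \<phi> \<longrightarrow> has_dir_deriv (\<lambda>y. \<phi> (\<psi> y)) (\<phi> d) \<xi> x)"

definition solves_system ::
    "('v::fin_dim_complex_vector \<Rightarrow> complex) set \<Rightarrow> complex \<Rightarrow> ('v \<Rightarrow> 'v) \<Rightarrow> bool" where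
  "solves_system A \<kappa> \<psi> \<longleftrightarrow>
     (\<forall>\<xi> x. (\<forall>\<alpha>\<in>A. \<alpha> x \<noteq> 0) \<longrightarrow>
        has_dir_deriv_field \<psi>
          (\<kappa> *\<^sub>C (\<Sum>\<alpha>\<in>A. (\<alpha> \<xi> * \<alpha> (\<psi> x) / \<alpha> x) *\<^sub>C vee A \<alpha>)) \<xi> x)"

text \<open>Generic points are those of some nonempty Zariski-open set.\<close>

definition generically_independent ::
    "'i set \<Rightarrow> ('i \<Rightarrow> 'v::complex_vector \<Rightarrow> 'v) \<Rightarrow> bool" where
  "generically_independent I \<psi> \<longleftrightarrow>
     (\<exists>p. polynomial_fun p \<and> (\<exists>x. p x \<noteq> 0) \<and>
        (\<forall>x. p x \<noteq> 0 \<longrightarrow> inj_on (\<lambda>i. \<psi> i x) I \<and> cindependent ((\<lambda>i. \<psi> i x) ` I)))"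

definition harmonic_with ::
    "('v::fin_dim_complex_vector \<Rightarrow> complex) set \<Rightarrow> (nat \<Rightarrow> complex) \<Rightarrow> (nat \<Rightarrow> 'v \<Rightarrow> 'v) \<Rightarrow> bool" where
  "harmonic_with A \<kappa> \<psi> \<longleftrightarrow>
     (let n = cdim (UNIV :: 'v set) in
        (\<forall>i\<in>{1..n}. \<kappa> i \<noteq> 0 \<and> polynomial_vector_field (\<psi> i) \<and> solves_system A (\<kappa> i) (\<psi> i)) \<and>
        generically_independent {1..n} \<psi> \<and>
        (\<Sum>i=1..n. \<kappa> i) = of_nat (card A))"

definition harmonic :: "('v::fin_dim_complex_vector \<Rightarrow> complex) set \<Rightarrow> bool" where
  "harmonic A \<longleftrightarrow> vee_system A \<and> (\<exists>\<kappa> \<psi>. harmonic_with A \<kappa> \<psi>)"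

definition potential_of ::
    "('v::fin_dim_complex_vector \<Rightarrow> complex) set \<Rightarrow> ('v \<Rightarrow> 'v) \<Rightarrow> ('v \<Rightarrow> complex) \<Rightarrow> bool" where
  "potential_of A \<psi> F \<longleftrightarrow>
     polynomial_fun F \<and> (\<forall>\<eta> x. has_dir_deriv F (canonical_form A (\<psi> x) \<eta>) \<eta> x)"

text \<open>
  The space of complex tuples modulo \<open>(1, \<dots>, 1)\<close>. The index type \<^typ>\<open>'m\<close> plays the role
  of \<open>{0, \<dots>, n}\<close>.
\<close>

quotient_type 'm tuple_mod_transl =
  "complex ^ 'm::finite" / "\<lambda>x y. \<exists>t. \<forall>i. x $ i = y $ i + t"
proof (rule equivpI)
  show "reflp (\<lambda>x y::complex ^ 'm. \<exists>t. \<forall>i. x $ i = y $ i + t)"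
    by (rule reflpI) (rule exI[of _ 0], simp)
  show "symp (\<lambda>x y::complex ^ 'm. \<exists>t. \<forall>i. x $ i = y $ i + t)"
  proof (rule sympI)
    fix x y :: "complex ^ 'm"
    assume "\<exists>t. \<forall>i. x $ i = y $ i + t"
    then obtain t where "\<forall>i. x $ i = y $ i + t" by blast
    then have "\<forall>i. y $ i = x $ i + (- t)" by simp
    then show "\<exists>t. \<forall>i. y $ i = x $ i + t" by blast
  qed
  show "transp (\<lambda>x y::complex ^ 'm. \<exists>t. \<forall>i. x $ i = y $ i + t)"
  proof (rule transpI)
    fix x y z :: "complex ^ 'm"
    assume "\<exists>t. \<forall>i. x $ i = y $ i + t" "\<exists>t. \<forall>i. y $ i = z $ i + t"
    then obtain s t where "\<forall>i. x $ i = y $ i + s" "\<forall>i. y $ i = z $ i + t" by blast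
    then have "\<forall>i. x $ i = z $ i + (t + s)" by simp
    then show "\<exists>t. \<forall>i. x $ i = z $ i + t" by blast
  qed
qed

lift_definition proj :: "complex ^ 'm \<Rightarrow> 'm::finite tuple_mod_transl" is "\<lambda>x. x" .

instantiation tuple_mod_transl :: (finite) complex_vector
begin

lift_definition zero_tuple_mod_transl :: "'a tuple_mod_transl" is 0 .

lift_definition plus_tuple_mod_transl ::
    "'a tuple_mod_transl \<Rightarrow> 'a tuple_mod_transl \<Rightarrow> 'a tuple_mod_transl" is "(+)"
proof -
  fix x x' y y' :: "complex ^ 'a"
  assume "\<exists>t. \<forall>i. x $ i = x' $ i + t" "\<exists>t. \<forall>i. y $ i = y' $ i + t"
  then obtain s t where "\<forall>i. x $ i = x' $ i + s" "\<forall>i. y $ i = y' $ i + t" by blast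
  then show "\<exists>t. \<forall>i. (x + y) $ i = (x' + y') $ i + t"
    by (intro exI[of _ "s + t"]) simp
qed

lift_definition uminus_tuple_mod_transl :: "'a tuple_mod_transl \<Rightarrow> 'a tuple_mod_transl" is uminus
proof -
  fix x x' :: "complex ^ 'a"
  assume "\<exists>t. \<forall>i. x $ i = x' $ i + t"
  then obtain t where "\<forall>i. x $ i = x' $ i + t" by blast
  then show "\<exists>t. \<forall>i. (- x) $ i = (- x') $ i + t"
    by (intro exI[of _ "- t"]) simp
qed

lift_definition minus_tuple_mod_transl ::
    "'a tuple_mod_transl \<Rightarrow> 'a tuple_mod_transl \<Rightarrow> 'a tuple_mod_transl" is "(-)"
proof -
  fix x x' y y' :: "complex ^ 'a"
  assume "\<exists>t. \<forall>i. x $ i = x' $ i + t" "\<exists>t. \<forall>i. y $ i = y' $ i + t"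
  then obtain s t where "\<forall>i. x $ i = x' $ i + s" "\<forall>i. y $ i = y' $ i + t" by blast
  then show "\<exists>t. \<forall>i. (x - y) $ i = (x' - y') $ i + t"
    by (intro exI[of _ "s - t"]) simp
qed

lift_definition scaleC_tuple_mod_transl ::
    "complex \<Rightarrow> 'a tuple_mod_transl \<Rightarrow> 'a tuple_mod_transl" is "(*s)"
proof -
  fix a :: complex and x x' :: "complex ^ 'a"
  assume "\<exists>t. \<forall>i. x $ i = x' $ i + t"
  then obtain t where "\<forall>i. x $ i = x' $ i + t" by blast
  then show "\<exists>t. \<forall>i. (a *s x) $ i = (a *s x') $ i + t"
    by (intro exI[of _ "a * t"]) (simp add: algebra_simps)
qed

instance
proof
  fix a b :: complex and x y z :: "'a tuple_mod_transl"
  show "x + y + z = x + (y + z)"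
    by transfer (rule exI[of _ 0], simp add: algebra_simps)
  show "x + y = y + x"
    by transfer (rule exI[of _ 0], simp add: algebra_simps)
  show "0 + x = x"
    by transfer (rule exI[of _ 0], simp)
  show "- x + x = 0"
    by transfer (rule exI[of _ 0], simp)
  show "x - y = x + - y"
    by transfer (rule exI[of _ 0], simp)
  show "a *\<^sub>C (x + y) = a *\<^sub>C x + a *\<^sub>C y"
    by transfer (rule exI[of _ 0], simp add: algebra_simps)
  show "(a + b) *\<^sub>C x = a *\<^sub>C x + b *\<^sub>C x"
    by transfer (rule exI[of _ 0], simp add: algebra_simps)
  show "a *\<^sub>C b *\<^sub>C x = (a * b) *\<^sub>C x"
    by transfer (rule exI[of _ 0], simp add: algebra_simps)
  show "1 *\<^sub>C x = x"
    by transfer (rule exI[of _ 0], simp)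
qed

end

lemma proj_zero: "proj 0 = 0"
  by transfer (rule exI[of _ 0], simp)

lemma proj_add: "proj (x + y) = proj x + proj y"
  by transfer (rule exI[of _ 0], simp)

lemma proj_scale: "proj (a *s x) = a *\<^sub>C proj x"
  by transfer (rule exI[of _ 0], simp)

lemma proj_sum: "proj (\<Sum>i\<in>I. f i) = (\<Sum>i\<in>I. proj (f i))"
  by (induction I rule: infinite_finite_induct) (simp_all add: proj_zero proj_add)

lemma proj_eq_iff: "proj x = proj y \<longleftrightarrow> (\<exists>t. \<forall>i. x $ i = y $ i + t)"
  by transfer (rule refl)

lemma proj_surj: "\<exists>x. v = proj x"
  by transfer (metis add.right_neutral)

instance tuple_mod_transl :: (finite) fin_dim_complex_vector
proof
  let ?B = "range (\<lambda>i::'a. proj (axis i 1))"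
  have "cspan ?B = UNIV"
  proof -
    have "v \<in> cspan ?B" for v :: "'a tuple_mod_transl"
    proof -
      obtain x where v: "v = proj x" using proj_surj by blast
      have "v = proj (\<Sum>i\<in>UNIV. x $ i *s axis i 1)" by (simp add: basis_expansion v)
      also have "\<dots> = (\<Sum>i\<in>UNIV. x $ i *\<^sub>C proj (axis i 1))"
        by (simp add: proj_sum proj_scale)
      finally show ?thesis
        by (auto intro: cvs.span_sum cvs.span_scale cvs.span_base)
    qed
    then show ?thesis by auto
  qed
  then have "\<forall>v. \<exists>a. v = (\<Sum>b\<in>?B. a b *\<^sub>C b)"
    using cvs.span_finite[of ?B] by auto
  then show "\<exists>B::'a tuple_mod_transl set. finite B \<and> (\<forall>v. \<exists>a. v = (\<Sum>b\<in>B. a b *\<^sub>C b))"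
    by (intro exI[of _ ?B]) simp
qed

lift_definition coord_diff :: "'m::finite \<Rightarrow> 'm \<Rightarrow> 'm tuple_mod_transl \<Rightarrow> complex"
  is "\<lambda>i j x. x $ i - x $ j"
  by fastforce

text \<open>
  Every notion above depends on a covector only up to sign, so the branch of the square root
  does not matter.
\<close>

definition A_system ::
    "('m::{finite,linorder} \<Rightarrow> complex) \<Rightarrow> ('m tuple_mod_transl \<Rightarrow> complex) set" where
  "A_system c = {\<lambda>v. csqrt (c i * c j) * coord_diff i j v | i j. i < j}"

text \<open>
  With \<open>\<lambda>\<^sub>j = k c\<^sub>j / \<sigma>\<close>, so that the \<open>\<lambda>\<^sub>j\<close> sum to \<open>k\<close>, the product of the
  \<open>(z - x\<^sub>j)\<close> to the powers \<open>\<lambda>\<^sub>j\<close> is single-valued near infinity, where it is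
  \<open>z\<^sup>k\<close> times the product of principal powers below; for \<open>\<bar>z\<bar> > \<bar>x\<^sub>j\<bar>\<close> the base
  \<open>1 - x\<^sub>j / z\<close> has positive real part.
\<close>

definition pochhammer_integral ::
    "('m::finite \<Rightarrow> complex) \<Rightarrow> nat \<Rightarrow> real \<Rightarrow> complex ^ 'm \<Rightarrow> complex" where
  "pochhammer_integral c k R x =
     1 / (2 * of_real pi * \<i>) *
     contour_integral (circlepath 0 R)
       (\<lambda>z. z ^ k * (\<Prod>j\<in>UNIV. (1 - x $ j / z) powr (of_nat k * c j / (\<Sum>i\<in>UNIV. c i))))"

end

theory Submission
  imports Defs "HOL-Complex_Analysis.Cauchy_Integral_Formula" "HOL-Analysis.Generalised_Binomial_Theorem"
    "HOL-Analysis.FPS_Convergence"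
begin

text \<open>
  Put \<open>Q\<^sub>\<mu>(u) = \<Prod>\<^sub>j (1 - x\<^sub>j u)\<close> with exponents \<open>\<mu>\<^sub>j\<close>, as a formal power series in \<open>u\<close>. The integral is
  the coefficient of \<open>u\<close> to the power \<open>\<kappa> + 1\<close> in \<open>Q\<^sub>\<lambda>\<close>, and its partial derivatives are multiples of
  the coefficients \<open>g\<^sub>i\<close> of \<open>u\<close> to the power \<open>\<kappa>\<close> in \<open>Q\<^sub>\<lambda> / (1 - x\<^sub>i u)\<close>. Comparing \<open>u Q'\<close> with
  these shows that the coefficient of order \<open>m + 1\<close> of \<open>Q\<^sub>\<mu>\<close> is translation invariant when
  \<open>\<Sum>\<^sub>j \<mu>\<^sub>j = m\<close>; together with the partial fraction identity for
  \<open>1 / (1 - x\<^sub>i u) - 1 / (1 - x\<^sub>j u)\<close> this gives the system for the gradients.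

  Expanding the geometric series, \<open>g\<^sub>i\<close> is the value at \<open>x\<^sub>i\<close> of a monic polynomial of degree \<open>\<kappa>\<close>
  that does not depend on \<open>i\<close>. A linear relation between the fields at a point with distinct
  coordinates is therefore a polynomial of degree at most \<open>n\<close> with \<open>n + 1\<close> zeros.

  The \<open>\<or>\<close>-condition holds for every subspace \<open>P\<close>, not only for planes: the differences
  \<open>e\<^sub>p - e\<^sub>q\<close> lying in \<open>P\<close> define an equivalence relation on the indices, and \<open>\<nu>\<close> is the share of
  the class of \<open>\<alpha>\<close> in the total weight \<open>\<sigma>\<close>.
\<close>

section \<open>Products of binomial series\<close>

unbundle no vec_syntax
unbundle fps_syntax

text \<open>Differentiation in a parameter \<open>t\<close>, one coefficient at a time, so that
  convergence of the series plays no part.\<close>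

definition fps_has_deriv :: "(complex \<Rightarrow> complex fps) \<Rightarrow> complex fps \<Rightarrow> complex \<Rightarrow> bool" where
  "fps_has_deriv f D s \<longleftrightarrow> (\<forall>n. ((\<lambda>t. f t $ n) has_field_derivative D $ n) (at s))"

lemma fps_has_deriv_mult:
  assumes "fps_has_deriv f Df s" "fps_has_deriv g Dg s"
  shows "fps_has_deriv (\<lambda>t. f t * g t) (Df * g s + f s * Dg) s"
  unfolding fps_has_deriv_def
proof
  fix n
  have "((\<lambda>t. \<Sum>i=0..n. f t $ i * g t $ (n - i)) has_field_derivative
      (\<Sum>i=0..n. Df $ i * g s $ (n - i) + f s $ i * Dg $ (n - i))) (at s)"
    using assms unfolding fps_has_deriv_def
    by (intro DERIV_sum) (auto intro!: derivative_eq_intros)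
  then show "((\<lambda>t. (f t * g t) $ n) has_field_derivative (Df * g s + f s * Dg) $ n) (at s)"
    by (simp add: fps_mult_nth sum.distrib)
qed

text \<open>The induction step shared by the two product rules below, one for a parameter and one
  for \<open>fps_X\<close>.\<close>

lemma sum_mult_prod_Diff_insert:
  fixes f g :: "'a \<Rightarrow> 'b::comm_semiring_1"
  assumes "finite A" "b \<notin> A"
  shows "(\<Sum>a\<in>insert b A. g a * prod f (insert b A - {a}))
    = g b * prod f A + f b * (\<Sum>a\<in>A. g a * prod f (A - {a}))"
proof -
  have "prod f (insert b A - {a}) = f b * prod f (A - {a})" if "a \<in> A" for a
  proof -
    have "insert b A - {a} = insert b (A - {a})" using that assms by auto
    then show ?thesis using assms by simp
  qed
  then show ?thesis
    using assms by (simp add: sum_distrib_left mult.left_commute insert_Diff_if cong: sum.cong)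
qed

lemma fps_has_deriv_prod:
  assumes "finite A" "\<And>a. a \<in> A \<Longrightarrow> fps_has_deriv (f a) (D a) s"
  shows "fps_has_deriv (\<lambda>t. \<Prod>a\<in>A. f a t) (\<Sum>a\<in>A. D a * (\<Prod>b\<in>A - {a}. f b s)) s"
  using assms
proof (induction A rule: finite_induct)
  case empty
  then show ?case by (simp add: fps_has_deriv_def)
next
  case (insert b A)
  then show ?case
    using fps_has_deriv_mult[of "f b" "D b" s "\<lambda>t. \<Prod>a\<in>A. f a t"]
    by (simp add: sum_mult_prod_Diff_insert[of A b D "\<lambda>a. f a s"] del: sum.insert)
qed

lemma fps_deriv_prod:
  fixes f :: "'a \<Rightarrow> 'b::comm_semiring_1 fps"
  assumes "finite A"
  shows "fps_deriv (prod f A) = (\<Sum>a\<in>A. fps_deriv (f a) * prod f (A - {a}))"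
  using assms
proof (induction A rule: finite_induct)
  case (insert b A)
  then show ?case
    by (simp add: sum_mult_prod_Diff_insert[of A b "\<lambda>a. fps_deriv (f a)" f] add.commute del: sum.insert)
qed simp

text \<open>The series of \<open>(1 - x X)\<close> to the power \<open>\<mu>\<close>.\<close>

definition binom_fps :: "complex \<Rightarrow> complex \<Rightarrow> complex fps" where
  "binom_fps \<mu> x = Abs_fps (\<lambda>n. (\<mu> gchoose n) * (- x) ^ n)"

lemma binom_fps_nth [simp]: "binom_fps \<mu> x $ n = (\<mu> gchoose n) * (- x) ^ n"
  by (simp add: binom_fps_def)

text \<open>Pascal's rule, read coefficient by coefficient.\<close>

lemma binom_fps_lower: "(1 - fps_const x * fps_X) * binom_fps (\<mu> - 1) x = binom_fps \<mu> x"
proof (rule fps_ext)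
  fix n
  show "((1 - fps_const x * fps_X) * binom_fps (\<mu> - 1) x) $ n = binom_fps \<mu> x $ n"
  proof (cases n)
    case (Suc m)
    then show ?thesis
      using gbinomial_Suc_Suc[of "\<mu> - 1" m] by (simp add: left_diff_distrib mult.assoc algebra_simps)
  qed (simp add: left_diff_distrib mult.assoc)
qed

text \<open>The usual derivative carries a factor \<open>- x * fps_X\<close>; writing it as
  \<open>(1 - x * fps_X) - 1\<close> leaves only series of the same family. On coefficients this is
  an absorption identity.\<close>

lemma fps_X_deriv_binom_fps:
  "fps_X * fps_deriv (binom_fps \<mu> x) = fps_const \<mu> * (binom_fps \<mu> x - binom_fps (\<mu> - 1) x)"
proof (rule fps_ext)
  fix n
  show "(fps_X * fps_deriv (binom_fps \<mu> x)) $ n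
      = (fps_const \<mu> * (binom_fps \<mu> x - binom_fps (\<mu> - 1) x)) $ n"
    using arg_cong[OF gbinomial_absorb_comp[of \<mu> n], of "\<lambda>y. y * (- x) ^ n"]
    by (cases n) (simp_all add: algebra_simps)
qed

text \<open>The chain rule lowers the exponent by one and produces a factor \<open>fps_X\<close>.
  Hence derivatives of coefficients of order \<open>Suc m\<close> involve coefficients of order
  \<open>m\<close>.\<close>

lemma fps_has_deriv_binom_fps:
  "fps_has_deriv (\<lambda>t. binom_fps \<mu> (x + t * \<xi>))
     (fps_const (- \<mu> * \<xi>) * (fps_X * binom_fps (\<mu> - 1) (x + s * \<xi>))) s"
  unfolding fps_has_deriv_def
proof
  fix n
  show "((\<lambda>t. binom_fps \<mu> (x + t * \<xi>) $ n) has_field_derivative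
      (fps_const (- \<mu> * \<xi>) * (fps_X * binom_fps (\<mu> - 1) (x + s * \<xi>))) $ n) (at s)"
  proof (cases n)
    case (Suc m)
    have "((\<lambda>t. (- (x + t * \<xi>)) ^ Suc m) has_field_derivative
        of_nat (Suc m) * (- (x + s * \<xi>)) ^ m * (- \<xi>)) (at s)"
      by (rule derivative_eq_intros refl | simp)+
    then have "((\<lambda>t. (\<mu> gchoose Suc m) * (- (x + t * \<xi>)) ^ Suc m) has_field_derivative
        (\<mu> gchoose Suc m) * (of_nat (Suc m) * (- (x + s * \<xi>)) ^ m * (- \<xi>))) (at s)"
      by (rule DERIV_cmult)
    also have "(\<mu> gchoose Suc m) * (of_nat (Suc m) * (- (x + s * \<xi>)) ^ m * (- \<xi>)) =
        (of_nat (Suc m) * (\<mu> gchoose Suc m)) * (- (x + s * \<xi>)) ^ m * (- \<xi>)"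
      by (simp only: ac_simps)
    also have "\<dots> = - \<mu> * \<xi> * ((\<mu> - 1 gchoose m) * (- (x + s * \<xi>)) ^ m)"
      by (simp only: gbinomial_absorption) simp
    finally show ?thesis
      by (simp add: Suc del: power_Suc gbinomial_0)
  qed simp
qed

lemma sums_binom_fps:
  assumes "norm (x * u) < 1"
  shows "(\<lambda>n. binom_fps \<mu> x $ n * u ^ n) sums (1 - x * u) powr \<mu>"
proof -
  have "(- (x * u)) ^ n = (- x) ^ n * u ^ n" for n
    by (metis mult_minus_left power_mult_distrib)
  then show ?thesis
    using gen_binomial_complex[of "- (x * u)" \<mu>] assms by (simp add: mult.assoc)
qed

section \<open>Products over all indices and the recurrences of their coefficients\<close>

definition binom_prod :: "('m::finite \<Rightarrow> complex) \<Rightarrow> ('m \<Rightarrow> complex) \<Rightarrow> complex fps" where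
  "binom_prod \<mu> x = (\<Prod>j\<in>UNIV. binom_fps (\<mu> j) (x j))"

text \<open>Lowering an exponent stands for division by \<open>1 - x j * fps_X\<close>, so that all
  quotients stay within the family \<open>binom_prod\<close>.\<close>

definition lower :: "'m \<Rightarrow> ('m \<Rightarrow> complex) \<Rightarrow> 'm \<Rightarrow> complex" where
  "lower j \<mu> = \<mu>(j := \<mu> j - 1)"

lemma binom_prod_lower_eq:
  "binom_prod (lower j \<mu>) x = binom_fps (\<mu> j - 1) (x j) * (\<Prod>i\<in>UNIV - {j}. binom_fps (\<mu> i) (x i))"
proof -
  have "(\<Prod>i\<in>UNIV - {j}. binom_fps (lower j \<mu> i) (x i)) = (\<Prod>i\<in>UNIV - {j}. binom_fps (\<mu> i) (x i))"
    by (rule prod.cong) (simp_all add: lower_def)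
  then show ?thesis
    unfolding binom_prod_def
    by (subst prod.remove[of UNIV j]) (simp_all add: lower_def[of j \<mu>, THEN fun_cong, of j])
qed

lemma binom_prod_eq:
  "binom_prod \<mu> x = binom_fps (\<mu> j) (x j) * (\<Prod>i\<in>UNIV - {j}. binom_fps (\<mu> i) (x i))"
  by (simp add: binom_prod_def prod.remove[of UNIV j "\<lambda>i. binom_fps (\<mu> i) (x i)"])

lemma sum_lower: "(\<Sum>i\<in>UNIV. lower j \<mu> i) = (\<Sum>i\<in>UNIV. \<mu> i) - 1" for j :: "'m::finite"
proof -
  have "lower j \<mu> = (\<lambda>i. \<mu> i - (if i = j then 1 else 0))"
    by (auto simp: lower_def)
  then show ?thesis by (simp add: sum_subtractf)
qed

lemma binom_prod_lower: "(1 - fps_const (x j) * fps_X) * binom_prod (lower j \<mu>) x = binom_prod \<mu> x"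
  unfolding binom_prod_lower_eq mult.assoc[symmetric] binom_fps_lower
  by (rule binom_prod_eq[symmetric])

lemma binom_prod_lower_nth_Suc:
  "binom_prod (lower j \<mu>) x $ Suc m = binom_prod \<mu> x $ Suc m + x j * binom_prod (lower j \<mu>) x $ m"
  using arg_cong[OF binom_prod_lower[of x j \<mu>], of "\<lambda>f. f $ Suc m"]
  by (simp add: left_diff_distrib mult.assoc diff_eq_eq)

lemma binom_prod_nth_0 [simp]: "binom_prod \<mu> x $ 0 = 1"
proof -
  have "(\<Prod>j\<in>A. binom_fps (\<mu> j) (x j)) $ 0 = 1" for A
    by (induction A rule: infinite_finite_induct) simp_all
  then show ?thesis by (simp add: binom_prod_def)
qed

text \<open>Expansion of \<open>1 / (1 - x j * fps_X)\<close> as a geometric series. The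
  coefficients of the powers of \<open>x j\<close> are the same for all \<open>j\<close>, which the
  independence argument exploits.\<close>

lemma binom_prod_lower_nth:
  "binom_prod (lower j \<mu>) x $ k = (\<Sum>m\<le>k. binom_prod \<mu> x $ (k - m) * x j ^ m)"
proof (induction k)
  case (Suc k)
  have "(\<Sum>m\<le>Suc k. binom_prod \<mu> x $ (Suc k - m) * x j ^ m)
      = binom_prod \<mu> x $ Suc k + x j * (\<Sum>m\<le>k. binom_prod \<mu> x $ (k - m) * x j ^ m)"
    by (subst sum.atMost_Suc_shift) (simp add: sum_distrib_left mult.left_commute)
  then show ?case
    by (simp only: binom_prod_lower_nth_Suc Suc)
qed simp

text \<open>Logarithmic differentiation expresses \<open>fps_X * Q'\<close> as the sum of the terms
  \<open>\<mu> j * (Q - Q / (1 - x j * fps_X))\<close>; then coefficients are compared. The right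
  side vanishes at the order equal to the sum of the exponents.\<close>

lemma binom_prod_euler:
  "(\<Sum>j\<in>UNIV. \<mu> j * binom_prod (lower j \<mu>) x $ m) = ((\<Sum>j\<in>UNIV. \<mu> j) - of_nat m) * binom_prod \<mu> x $ m"
proof -
  have "fps_X * fps_deriv (binom_prod \<mu> x) =
      (\<Sum>j\<in>UNIV. (fps_X * fps_deriv (binom_fps (\<mu> j) (x j))) * (\<Prod>i\<in>UNIV - {j}. binom_fps (\<mu> i) (x i)))"
    by (simp add: binom_prod_def fps_deriv_prod sum_distrib_left mult.assoc)
  also have "\<dots> = (\<Sum>j\<in>UNIV. fps_const (\<mu> j) * (binom_prod \<mu> x - binom_prod (lower j \<mu>) x))"
  proof (rule sum.cong)
    show "fps_X * fps_deriv (binom_fps (\<mu> j) (x j)) * (\<Prod>i\<in>UNIV - {j}. binom_fps (\<mu> i) (x i)) =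
        fps_const (\<mu> j) * (binom_prod \<mu> x - binom_prod (lower j \<mu>) x)" for j
      unfolding fps_X_deriv_binom_fps binom_prod_lower_eq binom_prod_eq[of \<mu> x j]
      by (simp add: algebra_simps)
  qed simp
  finally have "(fps_X * fps_deriv (binom_prod \<mu> x)) $ m =
      (\<Sum>j\<in>UNIV. fps_const (\<mu> j) * (binom_prod \<mu> x - binom_prod (lower j \<mu>) x)) $ m"
    by simp
  moreover have "(fps_X * fps_deriv (binom_prod \<mu> x)) $ m = of_nat m * binom_prod \<mu> x $ m"
    by (cases m) simp_all
  ultimately show ?thesis
    by (simp add: fps_sum_nth algebra_simps sum_subtractf sum_distrib_right)
qed

lemma has_field_derivative_binom_prod:
  "((\<lambda>t. binom_prod \<mu> (\<lambda>j. x j + t * \<xi> j) $ Suc m) has_field_derivative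
     - (\<Sum>j\<in>UNIV. \<mu> j * \<xi> j * binom_prod (lower j \<mu>) (\<lambda>j. x j + s * \<xi> j) $ m)) (at s)"
proof -
  have "fps_has_deriv (\<lambda>t. binom_prod \<mu> (\<lambda>j. x j + t * \<xi> j))
     (\<Sum>j\<in>UNIV. fps_const (- \<mu> j * \<xi> j) * (fps_X * binom_prod (lower j \<mu>) (\<lambda>j. x j + s * \<xi> j))) s"
    \<comment> \<open>The lowered products are split first, as unfolding \<open>binom_prod\<close>
      would hide them.\<close>
    unfolding binom_prod_lower_eq unfolding binom_prod_def mult.assoc[symmetric]
    by (rule fps_has_deriv_prod) (use fps_has_deriv_binom_fps in \<open>simp_all add: mult.assoc\<close>)
  then show ?thesis
    unfolding fps_has_deriv_def by (auto dest!: spec[of _ "Suc m"] simp: fps_sum_nth sum_negf)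
qed

text \<open>The derivative along \<open>(1, ..., 1)\<close> is minus the sum in
  \<open>binom_prod_euler\<close>, which is zero at this order.\<close>

lemma binom_prod_translate:
  assumes "(\<Sum>j\<in>UNIV. \<mu> j) = of_nat m"
  shows "binom_prod \<mu> (\<lambda>j. x j + t) $ Suc m = binom_prod \<mu> x $ Suc m"
proof -
  let ?f = "\<lambda>t. binom_prod \<mu> (\<lambda>j. x j + t * 1) $ Suc m"
  have "(?f has_field_derivative 0) (at s within UNIV)" for s
    using has_field_derivative_binom_prod[of \<mu> x "\<lambda>_. 1" m s] binom_prod_euler[of \<mu> "\<lambda>j. x j + s" m] assms
    by simp
  then have "\<exists>c. \<forall>t\<in>UNIV. ?f t = c"
    by (intro has_field_derivative_zero_constant) auto
  then obtain c where "\<And>t. ?f t = c" by auto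
  from this[of t] this[of 0] show ?thesis by simp
qed

section \<open>Contour integrals of expansions at infinity\<close>

text \<open>Convergence at the single point \<open>1 / M\<close> suffices, and one \<open>M\<close>
  serves all factors of a product.\<close>

lemma fps_conv_radius_binom_fps:
  assumes "M > 0" "cmod x < M"
  shows "fps_conv_radius (binom_fps \<mu> x) \<ge> ereal (1 / M)"
proof -
  have "cmod (x * of_real (1 / M)) < 1"
    using assms by (simp add: norm_mult norm_divide)
  from sums_binom_fps[OF this, of \<mu>] have "summable (\<lambda>n. binom_fps \<mu> x $ n * of_real (1 / M) ^ n)"
    by (rule sums_summable)
  from conv_radius_geI[OF this] show ?thesis
    using assms by (simp add: fps_conv_radius_def norm_divide)
qed

lemma fps_conv_radius_prod:
  fixes f :: "'a \<Rightarrow> complex fps"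
  assumes "\<And>a. a \<in> A \<Longrightarrow> fps_conv_radius (f a) \<ge> r"
  shows "fps_conv_radius (prod f A) \<ge> r"
  using assms
proof (induction A rule: infinite_finite_induct)
  case (insert a A)
  then show ?case
    using order_trans[OF _ fps_conv_radius_mult[of "f a" "prod f A"], of r] by simp
qed simp_all

lemma eval_fps_prod:
  fixes f :: "'a \<Rightarrow> complex fps"
  assumes "\<And>a. a \<in> A \<Longrightarrow> fps_conv_radius (f a) \<ge> r" "ereal (cmod z) < r"
  shows "eval_fps (prod f A) z = (\<Prod>a\<in>A. eval_fps (f a) z)"
  using assms
proof (induction A rule: infinite_finite_induct)
  case (insert a A)
  then have "cmod z < fps_conv_radius (f a)" "cmod z < fps_conv_radius (prod f A)"
    using fps_conv_radius_prod[of A r f] by (auto intro: less_le_trans)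
  then show ?case
    using insert by (simp add: eval_fps_mult)
qed simp_all

lemma fps_conv_radius_binom_prod:
  assumes "M > 0" "\<And>j. cmod (x j) < M"
  shows "fps_conv_radius (binom_prod \<mu> x) \<ge> ereal (1 / M)"
  unfolding binom_prod_def by (rule fps_conv_radius_prod) (rule fps_conv_radius_binom_fps[OF assms])

lemma eval_binom_prod:
  assumes "M > 0" "\<And>j. cmod (x j) < M" "cmod u < 1 / M"
  shows "eval_fps (binom_prod \<mu> x) u = (\<Prod>j\<in>UNIV. (1 - x j * u) powr \<mu> j)"
proof -
  have "cmod (x j * u) < 1" for j
  proof (cases "x j = 0")
    case False
    then have "cmod (x j) * cmod u < M * (1 / M)"
      using assms by (intro mult_strict_mono) auto
    then show ?thesis using assms by (simp add: norm_mult)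
  qed simp
  then have "eval_fps (binom_fps (\<mu> j) (x j)) u = (1 - x j * u) powr \<mu> j" for j
    using sums_binom_fps[of "x j" u "\<mu> j"] by (simp add: eval_fps_def sums_iff)
  moreover have "eval_fps (binom_prod \<mu> x) u = (\<Prod>j\<in>UNIV. eval_fps (binom_fps (\<mu> j) (x j)) u)"
    unfolding binom_prod_def using assms
    by (intro eval_fps_prod[where r = "ereal (1 / M)"] fps_conv_radius_binom_fps) auto
  ultimately show ?thesis by simp
qed

lemma eval_fps_shift_1:
  fixes f :: "complex fps"
  assumes "cmod u < fps_conv_radius f"
  shows "eval_fps f u = f $ 0 + u * eval_fps (fps_shift 1 f) u"
proof -
  have "f = fps_const (f $ 0) + fps_X * fps_shift 1 f"
    by (rule fps_ext) (simp split: nat.split)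
  moreover have "eval_fps (fps_const (f $ 0) + fps_X * fps_shift 1 f) u
      = f $ 0 + u * eval_fps (fps_shift 1 f) u"
    using assms fps_conv_radius_mult[of fps_X "fps_shift 1 f"]
    by (subst eval_fps_add) (auto simp: eval_fps_mult intro: less_le_trans)
  ultimately show ?thesis by metis
qed

lemma has_contour_integral_circlepath_0:
  assumes "R > 0" "\<And>z. z \<noteq> 0 \<Longrightarrow> (g has_field_derivative g' z) (at z)"
  shows "(g' has_contour_integral 0) (circlepath 0 R)"
proof (rule Cauchy_theorem_primitive)
  show "(g has_field_derivative g' z) (at z within sphere 0 R)" if "z \<in> sphere 0 R" for z
    by (rule has_field_derivative_at_within, rule assms(2)) (use assms(1) that in auto)
qed (use assms(1) in auto)

text \<open>Induction on \<open>k\<close> peels off the constant coefficient, which contributes a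
  monomial with a primitive. For \<open>k = 0\<close> the integrand is
  \<open>f $ 0 + f $ 1 / z\<close> plus a remainder divisible by \<open>1 / z ^ 2\<close>; the
  remainder has a primitive too, so only the middle term counts.\<close>

lemma has_contour_integral_eval_fps_inverse:
  fixes f :: "complex fps"
  assumes "R > 0" "ereal (1 / R) < fps_conv_radius f"
  shows "((\<lambda>z. z ^ k * eval_fps f (1 / z)) has_contour_integral 2 * of_real pi * \<i> * f $ Suc k)
    (circlepath 0 R)"
  using assms(2)
proof (induction k arbitrary: f)
  case 0
  let ?h = "fps_shift 1 (fps_shift 1 f)"
  have "eval_fps ?h holomorphic_on eball 0 (fps_conv_radius f)"
    by (intro holomorphic_intros) simp
  \<comment> \<open>A finite radius is chosen, as the radius of convergence may be infinite; the
    disc of radius \<open>r\<close> is convex and contains \<open>1 / z\<close> for every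
    \<open>z\<close> on the circle.\<close>
  obtain r where r: "1 / R < r" "ereal r < fps_conv_radius f"
    using ereal_dense2[OF 0] by force
  have "eval_fps ?h holomorphic_on ball 0 r"
    using r by (intro holomorphic_intros) (auto simp: in_eball_iff, meson less_ereal.simps(1) less_trans)
  then obtain H where H: "\<And>u. u \<in> ball 0 r \<Longrightarrow> (H has_field_derivative eval_fps ?h u) (at u within ball 0 r)"
    by (rule holomorphic_convex_primitive'[rotated 2]) auto
  \<comment> \<open>The substitution \<open>u = 1 / z\<close> turns a primitive \<open>H\<close> of
    the tail \<open>?h\<close> into one of the remainder.\<close>
  have H': "((\<lambda>z. - H (1 / z)) has_field_derivative eval_fps ?h (1 / z) / z ^ 2) (at z within sphere 0 R)"
    if z: "z \<in> sphere 0 R" for z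
  proof -
    have z: "z \<noteq> 0" "1 / z \<in> ball 0 r" using z assms(1) r by (auto simp: norm_divide)
    then have "(H has_field_derivative eval_fps ?h (1 / z)) (at (1 / z))"
      using H[of "1 / z"] by (simp add: at_within_open[of _ "ball 0 r"])
    moreover have "((\<lambda>z. 1 / z) has_field_derivative - (1 / z ^ 2)) (at z within sphere 0 R)"
      using z by (auto intro!: derivative_eq_intros simp: power2_eq_square)
    ultimately have "((\<lambda>z. H (1 / z)) has_field_derivative eval_fps ?h (1 / z) * - (1 / z ^ 2))
        (at z within sphere 0 R)"
      by (rule DERIV_chain2)
    then show ?thesis by (auto intro!: derivative_eq_intros)
  qed
  have 1: "((\<lambda>z. eval_fps ?h (1 / z) / z ^ 2) has_contour_integral 0) (circlepath 0 R)"
    by (rule Cauchy_theorem_primitive[OF H']) (use assms in auto)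
  have 2: "((\<lambda>z. f $ 0) has_contour_integral 0) (circlepath 0 R)"
    using assms(1)
    by (intro has_contour_integral_circlepath_0[where g = "\<lambda>z. f $ 0 * z"])
       (auto intro!: derivative_eq_intros)
  have 3: "((\<lambda>z. f $ 1 / (z - 0)) has_contour_integral 2 * of_real pi * \<i> * f $ 1) (circlepath 0 R)"
    using assms(1) by (intro Cauchy_integral_circlepath_simple) auto
  have "((\<lambda>z. f $ 0 + f $ 1 / (z - 0) + eval_fps ?h (1 / z) / z ^ 2) has_contour_integral
      0 + 2 * of_real pi * \<i> * f $ 1 + 0) (circlepath 0 R)"
    by (intro has_contour_integral_add 1 2 3)
  then have "((\<lambda>z. z ^ 0 * eval_fps f (1 / z)) has_contour_integral
      0 + 2 * of_real pi * \<i> * f $ 1 + 0) (circlepath 0 R)"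
  proof (rule has_contour_integral_eq)
    fix z assume "z \<in> path_image (circlepath 0 R)"
    then have "z \<noteq> 0" "cmod (1 / z) = 1 / R" using assms(1) by (auto simp: norm_divide)
    then show "f $ 0 + f $ 1 / (z - 0) + eval_fps ?h (1 / z) / z ^ 2 = z ^ 0 * eval_fps f (1 / z)"
      using 0 eval_fps_shift_1[of "1 / z" f] eval_fps_shift_1[of "1 / z" "fps_shift 1 f"]
      by (simp add: power2_eq_square field_simps)
  qed
  then show ?case by simp
next
  case (Suc k)
  have 1: "((\<lambda>z. z ^ k * eval_fps (fps_shift 1 f) (1 / z)) has_contour_integral
      2 * of_real pi * \<i> * fps_shift 1 f $ Suc k) (circlepath 0 R)"
    using Suc.prems by (intro Suc.IH) simp
  have 2: "((\<lambda>z. f $ 0 * z ^ Suc k) has_contour_integral 0) (circlepath 0 R)"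
  proof (rule has_contour_integral_circlepath_0[OF assms(1)])
    have "((\<lambda>z. z ^ Suc (Suc k) / of_nat (Suc (Suc k))) has_field_derivative
        of_nat (Suc (Suc k)) * z ^ Suc k / of_nat (Suc (Suc k))) (at z)" for z :: complex
      using DERIV_power[OF DERIV_ident[of "at z"], of "Suc (Suc k)"]
      by (intro DERIV_cdivide) (simp del: power_Suc of_nat_Suc)
    then show "((\<lambda>z. f $ 0 * (z ^ Suc (Suc k) / of_nat (Suc (Suc k)))) has_field_derivative f $ 0 * z ^ Suc k) (at z)"
      for z :: complex
      by (intro DERIV_cmult) (simp del: power_Suc of_nat_Suc)
  qed
  have "((\<lambda>z. f $ 0 * z ^ Suc k + z ^ k * eval_fps (fps_shift 1 f) (1 / z)) has_contour_integral
      0 + 2 * of_real pi * \<i> * fps_shift 1 f $ Suc k) (circlepath 0 R)"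
    by (intro has_contour_integral_add 1 2)
  then have "((\<lambda>z. z ^ Suc k * eval_fps f (1 / z)) has_contour_integral
      0 + 2 * of_real pi * \<i> * fps_shift 1 f $ Suc k) (circlepath 0 R)"
  proof (rule has_contour_integral_eq)
    fix z assume "z \<in> path_image (circlepath 0 R)"
    then have "z \<noteq> 0" "cmod (1 / z) = 1 / R" using assms(1) by (auto simp: norm_divide)
    then show "f $ 0 * z ^ Suc k + z ^ k * eval_fps (fps_shift 1 f) (1 / z) = z ^ Suc k * eval_fps f (1 / z)"
      using Suc.prems by (simp add: eval_fps_shift_1[of "1 / z" f] algebra_simps)
  qed
  then show ?case
    by (simp only: add_0 fps_shift_nth add_Suc_right One_nat_def add_0_right)
qed

unbundle no fps_syntax
unbundle vec_syntax

text \<open>On the circle the integrand is \<open>z ^ k\<close> times the sum of the product series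
  at \<open>1 / z\<close>.\<close>

lemma pochhammer_integral_eq:
  fixes x :: "complex ^ 'm::finite"
  assumes "\<And>j. cmod (x $ j) < R"
  shows "pochhammer_integral c k R x =
    fps_nth (binom_prod (\<lambda>j. of_nat k * c j / (\<Sum>i\<in>UNIV. c i)) (\<lambda>j. x $ j)) (Suc k)"
proof -
  let ?\<mu> = "\<lambda>j. of_nat k * c j / (\<Sum>i\<in>UNIV. c i)"
  \<comment> \<open>\<open>M\<close> lies strictly between the largest modulus and \<open>R\<close>,
    so that the lower bound \<open>1 / M\<close> for the radius of convergence exceeds
    \<open>1 / R\<close>.\<close>
  define M0 where "M0 = Max (insert 0 (range (\<lambda>j. cmod (x $ j))))"
  define M where "M = (M0 + R) / 2"
  have "M0 < R" "0 \<le> M0"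
    using assms le_less_trans[OF norm_ge_zero assms] by (auto simp: M0_def)
  have x_le: "cmod (x $ j) \<le> M0" for j
    unfolding M0_def by (rule Max_ge) auto
  have M: "M > 0" "M < R" "M0 < M"
    using \<open>M0 < R\<close> \<open>0 \<le> M0\<close> by (simp_all add: M_def)
  then have xM: "cmod (x $ j) < M" for j
    using x_le[of j] by simp
  have "R > 0" "1 / R < 1 / M" using M by (simp_all add: frac_less2)
  then have "ereal (1 / R) < fps_conv_radius (binom_prod ?\<mu> (\<lambda>j. x $ j))"
    using fps_conv_radius_binom_prod[of M "\<lambda>j. x $ j" ?\<mu>] M xM
    by (meson less_ereal.simps(1) less_le_trans)
  note has_contour_integral_eval_fps_inverse[OF \<open>R > 0\<close> this, of k]
  then have "((\<lambda>z. z ^ k * (\<Prod>j\<in>UNIV. (1 - x $ j / z) powr ?\<mu> j)) has_contour_integral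
      2 * of_real pi * \<i> * fps_nth (binom_prod ?\<mu> (\<lambda>j. x $ j)) (Suc k)) (circlepath 0 R)"
  proof (rule has_contour_integral_eq)
    fix z assume "z \<in> path_image (circlepath 0 R)"
    then have "cmod (1 / z) < 1 / M" using \<open>R > 0\<close> \<open>1 / R < 1 / M\<close> by (auto simp: norm_divide)
    then show "z ^ k * eval_fps (binom_prod ?\<mu> (\<lambda>j. x $ j)) (1 / z) =
        z ^ k * (\<Prod>j\<in>UNIV. (1 - x $ j / z) powr ?\<mu> j)"
      using eval_binom_prod[of M "\<lambda>j. x $ j" "1 / z" ?\<mu>] M xM by simp
  qed
  then show ?thesis
    by (simp add: pochhammer_integral_def contour_integral_unique)
qed

section \<open>Covectors and the system of type A\<close>

lemma covector_iff:
  "covector \<phi> \<longleftrightarrow> (\<forall>x y. \<phi> (x + y) = \<phi> x + \<phi> y) \<and> (\<forall>a x. \<phi> (a *\<^sub>C x) = a * \<phi> x)"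
  unfolding covector_def Vector_Spaces.linear_iff
  using cvs.vector_space_axioms vector_space_over_itself.vector_space_axioms by blast

lemma
  assumes "covector \<phi>"
  shows covector_add: "\<phi> (x + y) = \<phi> x + \<phi> y"
    and covector_scale: "\<phi> (a *\<^sub>C x) = a * \<phi> x"
  using assms by (auto simp: covector_iff)

lemma covector_zero: "covector \<phi> \<Longrightarrow> \<phi> 0 = 0"
  using covector_add[of \<phi> 0 0] by simp

lemma covector_diff: "covector \<phi> \<Longrightarrow> \<phi> (x - y) = \<phi> x - \<phi> y"
  using covector_add[of \<phi> "x - y" y] by simp

lemma covector_sum: "covector \<phi> \<Longrightarrow> \<phi> (\<Sum>i\<in>I. f i) = (\<Sum>i\<in>I. \<phi> (f i))"
  by (induction I rule: infinite_finite_induct) (simp_all add: covector_zero covector_add)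

lemma dual_subspace_covectors: "dual_subspace (Collect covector)"
  by (simp add: dual.subspace_def covector_iff scale_fun_def algebra_simps)

lemma canonical_form_diff_left:
  assumes "A \<subseteq> Collect covector"
  shows "canonical_form A (u - v) x = canonical_form A u x - canonical_form A v x"
  using assms
  by (auto simp: canonical_form_def covector_diff left_diff_distrib simp flip: sum_subtractf
      intro!: sum.cong)

lemma canonical_form_scale_left:
  assumes "A \<subseteq> Collect covector"
  shows "canonical_form A (a *\<^sub>C v) x = a * canonical_form A v x"
  using assms by (auto simp: canonical_form_def covector_scale sum_distrib_left intro!: sum.cong)

text \<open>Nondegeneracy gives the uniqueness demanded by the definite description in
  \<open>vee\<close>.\<close>

lemma vee_eqI:
  assumes "A \<subseteq> Collect covector" "nondegenerate (canonical_form A)"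
    and "\<And>x. canonical_form A v x = \<alpha> x"
  shows "vee A \<alpha> = v"
  unfolding vee_def
proof (rule the_equality)
  fix u assume "\<forall>x. canonical_form A u x = \<alpha> x"
  then have "\<forall>x. canonical_form A (u - v) x = 0"
    using assms by (simp add: canonical_form_diff_left)
  then show "u = v" using assms(2) by (auto simp: nondegenerate_def)
qed (use assms in simp)

text \<open>Independence is a property of the image set, so injectivity has to be derived as well:
  equal members would satisfy the relation with coefficients \<open>1\<close> and
  \<open>-1\<close>.\<close>

lemma independent_family:
  fixes f :: "'i \<Rightarrow> 'v::complex_vector"
  assumes "finite I" "\<And>a. (\<Sum>i\<in>I. a i *\<^sub>C f i) = 0 \<Longrightarrow> \<forall>i\<in>I. a i = 0"
  shows "inj_on f I" "cindependent (f ` I)"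
proof -
  show inj: "inj_on f I"
  proof (rule inj_onI, rule ccontr)
    fix i j assume ij: "i \<in> I" "j \<in> I" "f i = f j" "i \<noteq> j"
    define a :: "'i \<Rightarrow> complex" where "a = (\<lambda>l. (if l = i then 1 else 0) - (if l = j then 1 else 0))"
    have "(\<Sum>l\<in>I. a l *\<^sub>C f l) =
        (\<Sum>l\<in>I. if l = i then f l else 0) - (\<Sum>l\<in>I. if l = j then f l else 0)"
      unfolding sum_subtractf[symmetric]
      by (rule sum.cong) (auto simp: a_def cvs.scale_left_diff_distrib)
    then have "(\<Sum>l\<in>I. a l *\<^sub>C f l) = 0"
      using assms(1) ij by simp
    then show False using assms(2)[of a] ij by (auto simp: a_def)
  qed
  show "cindependent (f ` I)"
    unfolding cindependent_def cvs.dependent_finite[OF finite_imageI[OF assms(1)]]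
  proof safe
    fix u i assume "(\<Sum>v\<in>f ` I. u v *\<^sub>C v) = 0" "i \<in> I" "u (f i) \<noteq> 0"
    then show False
      using assms(2)[of "\<lambda>i. u (f i)"] by (simp add: sum.reindex[OF inj])
  qed
qed

section \<open>Coordinates on tuples modulo translation\<close>

lemma coord_diff_proj [simp]: "coord_diff i j (proj x) = x $ i - x $ j"
  by transfer simp

lemma covector_coord_diff: "covector (coord_diff i j)"
  unfolding covector_iff by (safe; transfer) (simp_all add: algebra_simps)

lemma proj_lambda: "proj (\<chi> i. y i) = (\<Sum>i\<in>UNIV. y i *\<^sub>C proj (axis i 1))"
  using arg_cong[OF basis_expansion[of "\<chi> i. y i"], of proj] by (simp add: proj_sum proj_scale)

lemma covector_proj:
  assumes "covector \<phi>"
  shows "\<phi> (proj (\<chi> i. y i)) = (\<Sum>i\<in>UNIV. y i * \<phi> (proj (axis i 1)))"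
  unfolding proj_lambda using assms by (simp add: covector_sum covector_scale)

text \<open>The differences against \<open>j\<close> form the representative whose entry at
  \<open>j\<close> is \<open>0\<close>.\<close>

lemma proj_coord_diff: "proj (\<chi> i. coord_diff i j v) = v"
proof -
  obtain x where "v = proj x" using proj_surj by blast
  then show ?thesis by (auto simp: proj_eq_iff intro!: exI[of _ "- x $ j"])
qed

lemma coord_diff_cocycle: "coord_diff i j v + coord_diff j l v = coord_diff i l v"
  by transfer simp

lemma coord_diff_self [simp]: "coord_diff i i v = 0"
  by transfer simp

lemma coord_diff_swap: "coord_diff j i v = - coord_diff i j v"
  by transfer simp

text \<open>The system is indexed by pairs \<open>i < j\<close>, whereas its sums are easier to
  evaluate over all ordered pairs.\<close>

lemma sum_less_pairs:
  fixes h :: "'m::{finite,linorder} \<Rightarrow> 'm \<Rightarrow> 'b::comm_monoid_add"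
  assumes "\<And>i. h i i = 0"
  shows "(\<Sum>(i, j)\<in>{(i, j). i < j}. h i j + h j i) = (\<Sum>i\<in>UNIV. \<Sum>j\<in>UNIV. h i j)"
proof -
  let ?h = "\<lambda>(i, j). h i j"
  have split: "(UNIV :: ('m \<times> 'm) set) =
      {(i, j). i < j} \<union> ({(i, j). j < i} \<union> {(i, j). i = j})"
    by auto
  have swap: "sum ?h {(i, j). j < i} = (\<Sum>(i, j)\<in>{(i, j). i < j}. h j i)"
    by (rule sum.reindex_bij_witness[of _ "\<lambda>(i, j). (j, i)" "\<lambda>(i, j). (j, i)"]) auto
  have diag: "sum ?h {(i, j). i = j} = 0"
    using assms by (intro sum.neutral) auto
  have "(\<Sum>i\<in>UNIV. \<Sum>j\<in>UNIV. h i j) = sum ?h UNIV"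
    by (simp add: sum.cartesian_product)
  also have "\<dots> = sum ?h {(i, j). i < j} + (sum ?h {(i, j). j < i} + sum ?h {(i, j). i = j})"
    unfolding split by (subst sum.union_disjoint; (subst sum.union_disjoint)?) auto
  finally show ?thesis
    unfolding swap diag by (simp add: sum.distrib split_def)
qed

section \<open>The canonical form and the dual vectors of the weighted system\<close>

locale A_weights =
  fixes c :: "'m::{finite,linorder} \<Rightarrow> complex"
  assumes c_nonzero: "c i \<noteq> 0" and sum_c_nonzero: "(\<Sum>i\<in>UNIV. c i) \<noteq> 0"
begin

abbreviation \<sigma> :: complex where "\<sigma> \<equiv> \<Sum>i\<in>UNIV. c i"

definition edge :: "'m \<Rightarrow> 'm \<Rightarrow> 'm tuple_mod_transl \<Rightarrow> complex" where
  "edge i j v = csqrt (c i * c j) * coord_diff i j v"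

text \<open>
  The canonical form pairs \<open>pt i\<close> with \<open>y\<close> to \<open>\<sigma> y\<^sub>i\<close> plus a term independent of \<open>i\<close>, so the vector
  dual to an edge is a multiple of a difference of two such points.
\<close>

definition pt :: "'m \<Rightarrow> 'm tuple_mod_transl" where
  "pt i = proj (axis i (1 / c i))"

lemma A_system_eq: "A_system c = (\<lambda>(i, j). edge i j) ` {(i, j). i < j}"
  by (auto simp: A_system_def edge_def[abs_def])

lemma edge_mem: "i < j \<Longrightarrow> edge i j \<in> A_system c"
  by (auto simp: A_system_eq)

lemma covector_edge: "covector (edge i j)"
  using covector_coord_diff[of i j] by (simp add: covector_iff edge_def algebra_simps)

lemma A_system_covector: "A_system c \<subseteq> Collect covector"
  by (auto simp: A_system_eq covector_edge)

lemma pt_scale: "pt i = (1 / c i) *\<^sub>C proj (axis i 1)"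
proof -
  have "axis i (1 / c i) = (1 / c i) *s axis i 1"
    by (simp add: axis_def vec_eq_iff)
  then show ?thesis by (simp add: pt_def proj_scale)
qed

lemma coord_diff_pt: "coord_diff p q (pt i) = ((if p = i then 1 else 0) - (if q = i then 1 else 0)) / c i"
  by (auto simp: pt_def axis_def)

lemma csqrt_mult_nonzero: "csqrt (c i * c j) \<noteq> 0"
  by (simp add: c_nonzero)

lemma csqrt_square: "csqrt (c i * c j) * csqrt (c i * c j) = c i * c j"
  by (metis power2_csqrt power2_eq_square)

text \<open>An edge is nonzero at the points \<open>pt\<close> of its two end indices and at no
  other \<open>pt\<close>, so proportional edges share their ends. This yields both injectivity of
  the indexing and non-collinearity.\<close>

lemma edge_eq_scale_imp_eq:
  assumes "i < j" "k < l" "edge i j = scale_fun a (edge k l)"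
  shows "i = k \<and> j = l"
proof -
  have "edge i j (pt i) \<noteq> 0" "edge i j (pt j) \<noteq> 0"
    using assms(1) by (auto simp: edge_def coord_diff_pt c_nonzero)
  then have "edge k l (pt i) \<noteq> 0" "edge k l (pt j) \<noteq> 0"
    using assms(3) by (auto simp: scale_fun_def)
  then have "i \<in> {k, l}" "j \<in> {k, l}"
    by (auto simp: edge_def coord_diff_pt split: if_splits)
  then show ?thesis using assms(1,2) by auto
qed

lemma edge_inj: "inj_on (\<lambda>(i, j). edge i j) {(i, j). i < j}"
proof (rule inj_onI, clarify)
  fix i j k l :: 'm
  assume "i < j" "k < l" "edge i j = edge k l"
  then show "i = k \<and> j = l"
    using edge_eq_scale_imp_eq[of i j k l 1] by (simp add: scale_fun_def)
qed

lemma sum_A_system: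
  "(\<Sum>\<alpha>\<in>A_system c. f \<alpha>) = (\<Sum>(i, j)\<in>{(i, j). i < j}. f (edge i j))"
  unfolding A_system_eq sum.reindex[OF edge_inj] by (simp add: split_def)

lemma card_A_system: "2 * card (A_system c) = CARD('m) * (CARD('m) - 1)"
proof -
  have "2 * card (A_system c) = (\<Sum>(i, j)\<in>{(i, j::'m). i < j}. 1 + 1)"
    unfolding A_system_eq by (simp add: card_image[OF edge_inj])
  \<comment> \<open>The constant is rewritten with a function that is zero on the diagonal, as
    \<open>sum_less_pairs\<close> requires.\<close>
  also have "\<dots> = (\<Sum>(i, j)\<in>{(i, j::'m). i < j}. (if i = j then 0 else 1) + (if j = i then 0 else 1))"
    by (intro sum.cong) auto
  also have "\<dots> = (\<Sum>i::'m\<in>UNIV. \<Sum>j::'m\<in>UNIV. if i = j then 0 else 1)"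
    by (rule sum_less_pairs) simp
  also have "\<dots> = (\<Sum>i::'m\<in>UNIV. CARD('m) - 1)"
  proof (rule sum.cong)
    have "(\<Sum>j\<in>UNIV. if i = j then 0 else 1) = (\<Sum>j\<in>UNIV - {i}. 1::nat)" for i :: 'm
      by (rule sum.mono_neutral_cong_right) auto
    then show "(\<Sum>j\<in>UNIV. if i = j then 0 else 1) = CARD('m) - 1" for i :: 'm
      by simp
  qed simp
  finally show ?thesis by simp
qed

text \<open>Each product of two differences splits into two terms exchanged by swapping
  \<open>i\<close> and \<open>j\<close>, so the sum over \<open>i < j\<close> becomes a full double
  sum, which factors.\<close>

lemma canonical_form_proj:
  "canonical_form (A_system c) (proj x) (proj y) =
     \<sigma> * (\<Sum>i\<in>UNIV. c i * x $ i * y $ i) - (\<Sum>i\<in>UNIV. c i * x $ i) * (\<Sum>i\<in>UNIV. c i * y $ i)"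
proof -
  have "canonical_form (A_system c) (proj x) (proj y) =
      (\<Sum>(i, j)\<in>{(i, j). i < j}. c i * c j * (x $ i - x $ j) * y $ i + c j * c i * (x $ j - x $ i) * y $ j)"
    unfolding canonical_form_def sum_A_system
  proof (intro sum.cong refl, clarify)
    fix i j
    have "edge i j (proj x) * edge i j (proj y) =
        (csqrt (c i * c j) * csqrt (c i * c j)) * ((x $ i - x $ j) * (y $ i - y $ j))"
      by (simp add: edge_def)
    then show "edge i j (proj x) * edge i j (proj y) =
        c i * c j * (x $ i - x $ j) * y $ i + c j * c i * (x $ j - x $ i) * y $ j"
      by (simp add: csqrt_square algebra_simps)
  qed
  also have "\<dots> = (\<Sum>i\<in>UNIV. \<Sum>j\<in>UNIV. c i * c j * (x $ i - x $ j) * y $ i)"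
    by (rule sum_less_pairs) simp
  also have "\<dots> = (\<Sum>i\<in>UNIV. c i * x $ i * y $ i * \<sigma> - c i * y $ i * (\<Sum>j\<in>UNIV. c j * x $ j))"
    by (simp add: sum_distrib_left algebra_simps sum_subtractf)
  finally show ?thesis
    by (simp add: sum_subtractf sum_distrib_left sum_distrib_right mult.commute)
qed

lemma canonical_form_pt_proj:
  "canonical_form (A_system c) (pt i) (proj y) = \<sigma> * y $ i - (\<Sum>j\<in>UNIV. c j * y $ j)"
proof -
  have "c j * axis i (1 / c i) $ j = (if j = i then 1 else 0)" for j
    by (simp add: axis_def c_nonzero)
  then show ?thesis
    unfolding pt_def canonical_form_proj by (simp add: if_distrib[of "\<lambda>a. a * _"] cong: if_cong)
qed

text \<open>Orthogonality to every \<open>pt i\<close> forces each coordinate to equal the weighted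
  mean, so the tuple is constant.\<close>

lemma nondegenerate_A_system: "nondegenerate (canonical_form (A_system c))"
  unfolding nondegenerate_def
proof (intro allI impI)
  fix v assume G: "\<forall>u. canonical_form (A_system c) v u = 0"
  obtain y where v: "v = proj y" using proj_surj by blast
  have "canonical_form (A_system c) (pt i) v = 0" for i
    using G[rule_format, of "pt i"] by (simp add: canonical_form_def mult.commute)
  then have "y $ i = (\<Sum>j\<in>UNIV. c j * y $ j) / \<sigma>" for i
    using sum_c_nonzero by (simp add: v canonical_form_pt_proj field_simps)
  then have "\<exists>t. \<forall>i. y $ i = t" by blast
  then have "proj y = proj 0"
    by (simp add: proj_eq_iff)
  then show "v = 0" by (simp add: v proj_zero)
qed

lemma vee_edge: "vee (A_system c) (edge i j) = (csqrt (c i * c j) / \<sigma>) *\<^sub>C (pt i - pt j)"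
proof (rule vee_eqI[OF A_system_covector nondegenerate_A_system])
  fix v :: "'m tuple_mod_transl"
  obtain y where v: "v = proj y" using proj_surj by blast
  show "canonical_form (A_system c) ((csqrt (c i * c j) / \<sigma>) *\<^sub>C (pt i - pt j)) v = edge i j v"
    using sum_c_nonzero
    by (simp add: v canonical_form_scale_left[OF A_system_covector] canonical_form_pt_proj
        canonical_form_diff_left[OF A_system_covector] edge_def right_diff_distrib)
qed

text \<open>Collects the coefficient of each \<open>pt i\<close>; antisymmetry makes the diagonal
  weights vanish.\<close>

lemma sum_less_pairs_pt:
  assumes "\<And>i j. w j i = - w i j"
  shows "(\<Sum>(i, j)\<in>{(i, j). i < j}. w i j *\<^sub>C (pt i - pt j)) = (\<Sum>i\<in>UNIV. (\<Sum>j\<in>UNIV. w i j) *\<^sub>C pt i)"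
proof -
  have "w i i = 0" for i
    using assms[of i i] by simp
  then have "(\<Sum>(i, j)\<in>{(i, j). i < j}. w i j *\<^sub>C pt i + w j i *\<^sub>C pt j) =
      (\<Sum>i\<in>UNIV. \<Sum>j\<in>UNIV. w i j *\<^sub>C pt i)"
    by (intro sum_less_pairs) simp
  moreover have "w i j *\<^sub>C pt i + w j i *\<^sub>C pt j = w i j *\<^sub>C (pt i - pt j)" for i j
    unfolding assms[of j i] by (simp add: cvs.scale_right_diff_distrib)
  ultimately show ?thesis
    by (simp add: cvs.scale_sum_left)
qed

section \<open>The defining conditions of a \<or>-system\<close>

lemma coord_diff_mem_iff:
  assumes "dual_subspace P"
  shows "edge i j \<in> P \<longleftrightarrow> coord_diff i j \<in> P"
proof
  have "coord_diff i j = scale_fun (1 / csqrt (c i * c j)) (edge i j)"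
    by (auto simp: scale_fun_def edge_def csqrt_mult_nonzero simp del: csqrt_eq_0)
  then show "coord_diff i j \<in> P" if "edge i j \<in> P"
    using dual.subspace_scale[OF assms that] by simp
  have "edge i j = scale_fun (csqrt (c i * c j)) (coord_diff i j)"
    by (auto simp: scale_fun_def edge_def)
  then show "edge i j \<in> P" if "coord_diff i j \<in> P"
    using dual.subspace_scale[OF assms that] by simp
qed

text \<open>The coefficient of \<open>pt p\<close> is a sum over the class of \<open>p\<close>. Its
  part with \<open>e p\<close> carries the weight of that class, and its part with
  \<open>e q\<close> cancels because \<open>i\<close> and \<open>j\<close> are equivalent. What
  remains is proportional to \<open>e p\<close>.\<close>

lemma vee_condition:
  assumes P: "dual_subspace P" "edge i j \<in> P"
  shows "\<exists>\<nu>. (\<Sum>\<beta>\<in>P \<inter> A_system c. \<beta> (vee (A_system c) (edge i j)) *\<^sub>C vee (A_system c) \<beta>)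
    = \<nu> *\<^sub>C vee (A_system c) (edge i j)"
proof -
  let ?a = "vee (A_system c) (edge i j)"
  define R where "R p q \<longleftrightarrow> coord_diff p q \<in> P" for p q
  have R_refl: "R p p" for p
  proof -
    have "coord_diff p p = 0" by (auto simp: zero_fun_def)
    then show ?thesis using dual.subspace_0[OF P(1)] by (simp add: R_def)
  qed
  have R_sym: "R q p" if "R p q" for p q
  proof -
    have "coord_diff q p = scale_fun (- 1) (coord_diff p q)"
      by (rule ext) (simp add: scale_fun_def coord_diff_swap[of q p])
    then show ?thesis using dual.subspace_scale[OF P(1), of _ "- 1"] that by (simp add: R_def)
  qed
  have R_trans: "R p r" if "R p q" "R q r" for p q r
  proof -
    have "coord_diff p r = coord_diff p q + coord_diff q r"
      by (rule ext) (simp add: coord_diff_cocycle)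
    then show ?thesis using dual.subspace_add[OF P(1)] that by (simp add: R_def)
  qed
  have Rij: "R i j"
    using P by (simp add: R_def coord_diff_mem_iff)
  define s where "s = csqrt (c i * c j) / \<sigma>"
  have a: "?a = s *\<^sub>C (pt i - pt j)"
    by (simp add: vee_edge s_def)
  \<comment> \<open>The coefficients of \<open>pt i - pt j\<close> with respect to the points
    \<open>pt p\<close>.\<close>
  define e where "e p = (if p = i then 1 else 0) - (if p = j then 1 else 0 :: complex)" for p
  have coord_a: "coord_diff p q ?a = s * (e p / c p - e q / c q)" for p q
    by (auto simp: a e_def covector_scale[OF covector_coord_diff] covector_diff[OF covector_coord_diff]
        coord_diff_pt)
  define w where "w p q = (if R p q then c p * c q / \<sigma> * coord_diff p q ?a else 0)" for p q
  have "(\<Sum>\<beta>\<in>P \<inter> A_system c. \<beta> ?a *\<^sub>C vee (A_system c) \<beta>) =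
      (\<Sum>\<beta>\<in>A_system c. if \<beta> \<in> P then \<beta> ?a *\<^sub>C vee (A_system c) \<beta> else 0)"
    unfolding Int_commute[of P] by (rule sum.inter_restrict) (simp add: A_system_eq)
  also have "\<dots> = (\<Sum>(p, q)\<in>{(p, q). p < q}. w p q *\<^sub>C (pt p - pt q))"
    unfolding sum_A_system
  proof (intro sum.cong refl, clarify)
    fix p q :: 'm
    have "edge p q ?a * (csqrt (c p * c q) / \<sigma>) =
        (csqrt (c p * c q) * csqrt (c p * c q)) / \<sigma> * coord_diff p q ?a"
      by (simp add: edge_def)
    then show "(if edge p q \<in> P then edge p q ?a *\<^sub>C vee (A_system c) (edge p q) else 0) =
        w p q *\<^sub>C (pt p - pt q)"
      by (simp add: vee_edge[of p q] coord_diff_mem_iff[OF P(1)] w_def R_def csqrt_square scaleC_scaleC)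
  qed
  also have "\<dots> = (\<Sum>p\<in>UNIV. (\<Sum>q\<in>UNIV. w p q) *\<^sub>C pt p)"
  proof (rule sum_less_pairs_pt)
    show "w q p = - w p q" for p q
      using R_sym[of p q] R_sym[of q p] by (auto simp: w_def coord_diff_swap[of q p])
  qed
  also have "\<dots> = (\<Sum>p\<in>UNIV. (s / \<sigma> * (\<Sum>q\<in>{q. R i q}. c q) * e p) *\<^sub>C pt p)"
  proof (intro sum.cong refl arg_cong2[where f = scaleC])
    fix p
    have "(\<Sum>q\<in>UNIV. w p q) = (\<Sum>q\<in>{q. R p q}. c p * c q / \<sigma> * coord_diff p q ?a)"
      unfolding w_def by (simp add: sum.If_cases)
    also have "\<dots> = (\<Sum>q\<in>{q. R p q}. s / \<sigma> * (e p * c q - c p * e q))"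
      by (intro sum.cong refl) (simp add: coord_a c_nonzero sum_c_nonzero field_simps)
    also have "\<dots> = s / \<sigma> * (e p * (\<Sum>q\<in>{q. R p q}. c q) - c p * (\<Sum>q\<in>{q. R p q}. e q))"
      by (simp add: sum_distrib_left sum_subtractf right_diff_distrib mult.assoc)
    also have "(\<Sum>q\<in>{q. R p q}. e q) = (if R p i then 1 else 0) - (if R p j then 1 else 0)"
      by (simp add: e_def sum_subtractf)
    \<comment> \<open>A class contains either both of \<open>i\<close> and \<open>j\<close> or
      neither.\<close>
    also have "\<dots> = 0"
      using R_trans[of p i j] R_trans[of p j i] Rij R_sym[of i j] by auto
    \<comment> \<open>Where \<open>e p\<close> is nonzero, \<open>p\<close> is \<open>i\<close> or
      \<open>j\<close>, so its class is that of \<open>i\<close>.\<close>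
    also have "e p * (\<Sum>q\<in>{q. R p q}. c q) = (\<Sum>q\<in>{q. R i q}. c q) * e p"
    proof -
      have "{q. R p q} = {q. R i q}" if "e p \<noteq> 0"
        using that R_trans[of i j] R_trans[of j i] Rij R_sym[of i j] by (auto simp: e_def split: if_splits)
      then show ?thesis by (cases "e p = 0") auto
    qed
    finally show "(\<Sum>q\<in>UNIV. w p q) = s / \<sigma> * (\<Sum>q\<in>{q. R i q}. c q) * e p"
      by simp
  qed
  also have "\<dots> = (s / \<sigma> * (\<Sum>q\<in>{q. R i q}. c q)) *\<^sub>C (\<Sum>p\<in>UNIV. e p *\<^sub>C pt p)"
    by (simp add: cvs.scale_sum_right scaleC_scaleC)
  also have "(\<Sum>p\<in>UNIV. e p *\<^sub>C pt p) = pt i - pt j"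
  proof -
    have "(\<Sum>p\<in>UNIV. e p *\<^sub>C pt p) = (\<Sum>p\<in>UNIV. if p = i then pt p else 0) - (\<Sum>p\<in>UNIV. if p = j then pt p else 0)"
      unfolding sum_subtractf[symmetric]
      by (rule sum.cong) (auto simp: e_def cvs.scale_left_diff_distrib)
    then show ?thesis by simp
  qed
  also have "(s / \<sigma> * (\<Sum>q\<in>{q. R i q}. c q)) *\<^sub>C (pt i - pt j) = ((\<Sum>q\<in>{q. R i q}. c q) / \<sigma>) *\<^sub>C ?a"
    by (simp add: a scaleC_scaleC mult.commute)
  finally show ?thesis by blast
qed

text \<open>Evaluating a covector on the representative that vanishes at a fixed index writes it as
  a combination of coordinate differences.\<close>

lemma span_A_system: "dual_span (A_system c) = Collect covector"
proof
  show "dual_span (A_system c) \<subseteq> Collect covector"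
    by (rule dual.span_minimal[OF A_system_covector dual_subspace_covectors])
  have sub: "dual_subspace (dual_span (A_system c))"
    by (rule dual.subspace_span)
  have less: "coord_diff i j \<in> dual_span (A_system c)" if "i < j" for i j
    using dual.span_base[OF edge_mem[OF that]] coord_diff_mem_iff[OF sub] by simp
  have mem: "coord_diff i j \<in> dual_span (A_system c)" for i j
  proof (cases i j rule: linorder_cases)
    case equal
    then have "coord_diff i j = 0" by (auto simp: zero_fun_def)
    then show ?thesis using dual.span_zero by simp
  next
    case greater
    have "coord_diff i j = scale_fun (- 1) (coord_diff j i)"
      by (rule ext) (simp add: scale_fun_def coord_diff_swap[of i j])
    then show ?thesis using dual.span_scale[OF less[OF greater], of "- 1"] by simp
  qed (rule less)
  show "Collect covector \<subseteq> dual_span (A_system c)"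
  proof
    fix \<phi> :: "'m tuple_mod_transl \<Rightarrow> complex" assume "\<phi> \<in> Collect covector"
    then have \<phi>: "covector \<phi>" by simp
    \<comment> \<open>An arbitrary base index.\<close>
    define j :: 'm where "j = undefined"
    have "\<phi> = (\<Sum>i\<in>UNIV. scale_fun (\<phi> (proj (axis i 1))) (coord_diff i j))"
    proof
      fix v
      have "(\<Sum>i\<in>I. scale_fun (\<phi> (proj (axis i 1))) (coord_diff i j)) v =
          (\<Sum>i\<in>I. coord_diff i j v * \<phi> (proj (axis i 1)))" for I
        by (induction I rule: infinite_finite_induct) (simp_all add: scale_fun_def mult.commute)
      then show "\<phi> v = (\<Sum>i\<in>UNIV. scale_fun (\<phi> (proj (axis i 1))) (coord_diff i j)) v"
        using covector_proj[OF \<phi>, of "\<lambda>i. coord_diff i j v"] by (simp add: proj_coord_diff)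
    qed
    also have "\<dots> \<in> dual_span (A_system c)"
      by (intro dual.span_sum dual.span_scale mem)
    finally show "\<phi> \<in> dual_span (A_system c)" .
  qed
qed

lemma vee_system_A_system: "vee_system (A_system c)"
proof -
  have "dual_independent {\<alpha>, \<beta>}" if "\<alpha> \<in> A_system c" "\<beta> \<in> A_system c" "\<alpha> \<noteq> \<beta>" for \<alpha> \<beta>
  proof -
    obtain i j where ij: "i < j" "\<alpha> = edge i j"
      using \<open>\<alpha> \<in> A_system c\<close> by (auto simp: A_system_eq)
    obtain k l where kl: "k < l" "\<beta> = edge k l"
      using \<open>\<beta> \<in> A_system c\<close> by (auto simp: A_system_eq)
    have "\<beta> (pt k) \<noteq> 0" using kl by (auto simp: edge_def coord_diff_pt c_nonzero)
    then have "\<beta> \<noteq> 0" by auto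
    moreover have "\<alpha> \<notin> dual_span {\<beta>}"
      unfolding dual.span_singleton using edge_eq_scale_imp_eq[of i j k l] ij kl that(3) by auto
    ultimately show ?thesis
      using that(3) by (simp add: dual_independent_def dual.independent_insert)
  qed
  moreover have "\<exists>\<nu>. (\<Sum>\<beta>\<in>P \<inter> A_system c. \<beta> (vee (A_system c) \<alpha>) *\<^sub>C vee (A_system c) \<beta>)
      = \<nu> *\<^sub>C vee (A_system c) \<alpha>"
    if "\<alpha> \<in> A_system c" "dual_subspace P" "\<alpha> \<in> P" for \<alpha> P
  proof -
    from that obtain i j where "\<alpha> = edge i j"
      by (auto simp: A_system_eq)
    then show ?thesis using that vee_condition by blast
  qed
  moreover have "finite (A_system c)"
    by (simp add: A_system_eq)
  ultimately show ?thesis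
    unfolding vee_system_def
    using A_system_covector span_A_system nondegenerate_A_system by blast
qed

end

section \<open>Potentials and solutions\<close>

lemma polynomial_fun_sum:
  assumes "\<And>i. i \<in> I \<Longrightarrow> polynomial_fun (f i)"
  shows "polynomial_fun (\<lambda>v. \<Sum>i\<in>I. f i v)"
  using assms
  by (induction I rule: infinite_finite_induct) (auto intro: polynomial_fun.intros)

lemma polynomial_fun_prod:
  assumes "\<And>i. i \<in> I \<Longrightarrow> polynomial_fun (f i)"
  shows "polynomial_fun (\<lambda>v. \<Prod>i\<in>I. f i v)"
  using assms
  by (induction I rule: infinite_finite_induct) (auto intro: polynomial_fun.intros)

lemma polynomial_fun_power:
  assumes "polynomial_fun f"
  shows "polynomial_fun (\<lambda>v. f v ^ n)"
  using polynomial_fun_prod[of "{..<n}" "\<lambda>_. f"] assms by simp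

lemma polynomial_fun_uminus:
  assumes "polynomial_fun f"
  shows "polynomial_fun (\<lambda>v. - f v)"
  using polynomial_fun.mult[OF polynomial_fun.const[of "- 1"] assms] by simp

text \<open>Coefficients of a product are convolutions, so the induction over the factors treats all
  orders at once.\<close>

lemma polynomial_fun_binom_prod:
  assumes "\<And>j. polynomial_fun (\<lambda>v. x v j)"
  shows "polynomial_fun (\<lambda>v. fps_nth (binom_prod \<mu> (x v)) m)"
proof -
  have "polynomial_fun (\<lambda>v. fps_nth (\<Prod>j\<in>J. binom_fps (\<mu> j) (x v j)) m)" for J
  proof (induction J arbitrary: m rule: infinite_finite_induct)
    case (insert j J)
    then show ?case
      by (simp add: fps_mult_nth)
         (intro polynomial_fun_sum polynomial_fun.mult polynomial_fun.const polynomial_fun_power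
            polynomial_fun_uminus assms)
  qed (simp_all add: polynomial_fun.const)
  then show ?thesis by (simp add: binom_prod_def)
qed

text \<open>By \<open>binom_prod_euler\<close> the added multiple of \<open>\<xi> i\<close> is zero.
  It serves to express the derivative through differences, with \<open>i\<close> free to
  choose.\<close>

lemma has_field_derivative_binom_prod_translation_invariant:
  assumes "(\<Sum>j\<in>UNIV. \<mu> j) = of_nat m"
  shows "((\<lambda>t. fps_nth (binom_prod \<mu> (\<lambda>j. x j + t * \<xi> j)) (Suc m)) has_field_derivative
     (\<Sum>j\<in>UNIV. \<mu> j * (\<xi> i - \<xi> j) * fps_nth (binom_prod (lower j \<mu>) x) m)) (at 0)"
proof -
  have "(\<Sum>j\<in>UNIV. \<mu> j * (\<xi> i - \<xi> j) * fps_nth (binom_prod (lower j \<mu>) x) m) =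
      \<xi> i * (\<Sum>j\<in>UNIV. \<mu> j * fps_nth (binom_prod (lower j \<mu>) x) m)
      - (\<Sum>j\<in>UNIV. \<mu> j * \<xi> j * fps_nth (binom_prod (lower j \<mu>) x) m)"
    by (simp add: sum_distrib_left algebra_simps sum_subtractf)
  then show ?thesis
    using has_field_derivative_binom_prod[of \<mu> x \<xi> m 0] by (simp add: binom_prod_euler assms)
qed

lemma lower_commute: "i \<noteq> j \<Longrightarrow> lower i (lower j \<mu>) = lower j (lower i \<mu>)"
  by (auto simp: lower_def)

text \<open>Coefficient form of the partial fraction identity: the product with both exponents
  lowered is reached by lowering either one first, and the two recurrences are subtracted.\<close>

lemma binom_prod_lower_diff:
  assumes "i \<noteq> j"
  shows "fps_nth (binom_prod (lower i \<mu>) x) (Suc m) - fps_nth (binom_prod (lower j \<mu>) x) (Suc m)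
    = (x i - x j) * fps_nth (binom_prod (lower j (lower i \<mu>)) x) m"
  using binom_prod_lower_nth_Suc[of j "lower i \<mu>" x m] binom_prod_lower_nth_Suc[of i "lower j \<mu>" x m]
  by (simp add: lower_commute[OF assms] algebra_simps)

section \<open>Linear independence by counting roots, and the dimension\<close>

definition lower_poly :: "('m::finite \<Rightarrow> complex) \<Rightarrow> ('m \<Rightarrow> complex) \<Rightarrow> nat \<Rightarrow> complex poly" where
  "lower_poly \<mu> x k = (\<Sum>m\<le>k. monom (fps_nth (binom_prod \<mu> x) (k - m)) m)"

lemma poly_lower_poly: "poly (lower_poly \<mu> x k) (x i) = fps_nth (binom_prod (lower i \<mu>) x) k"
  by (simp add: lower_poly_def poly_sum poly_monom binom_prod_lower_nth)

lemma coeff_lower_poly: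
  "coeff (lower_poly \<mu> x k) l = (if l \<le> k then fps_nth (binom_prod \<mu> x) (k - l) else 0)"
  by (simp add: lower_poly_def coeff_sum)

lemma degree_lower_poly_le: "degree (lower_poly \<mu> x k) \<le> k"
  by (rule degree_le) (simp add: coeff_lower_poly)

text \<open>A polynomial of degree at most \<open>n\<close> vanishes at more than \<open>n\<close>
  points and so is zero. The constant \<open>t\<close> is there because a relation in the quotient
  space determines tuples only up to translation.\<close>

lemma lower_poly_combination_eq_0:
  fixes b :: "nat \<Rightarrow> complex" and x :: "'m::finite \<Rightarrow> complex"
  assumes "inj x" "n < CARD('m)"
    and eq: "\<And>i. (\<Sum>k=1..n. b k * fps_nth (binom_prod (lower i (\<mu> k)) x) k) = t"
    and "k \<in> {1..n}"
  shows "b k = 0"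
proof (rule ccontr)
  assume "b k \<noteq> 0"
  define r where "r = (\<Sum>k=1..n. smult (b k) (lower_poly (\<mu> k) x k)) - [:t:]"
  have "degree r \<le> n"
    unfolding r_def
    by (intro degree_diff_le degree_sum_le)
      (auto intro: order_trans[OF degree_smult_le] order_trans[OF degree_lower_poly_le])
  have roots: "range x \<subseteq> {z. poly r z = 0}"
    using eq by (auto simp: r_def poly_sum poly_lower_poly)
  have "r = 0"
  proof (rule ccontr)
    assume "r \<noteq> 0"
    then have "card (range x) \<le> degree r"
      using card_mono[OF poly_roots_finite[of r] roots] card_poly_roots_bound[of r] by linarith
    then show False
      using \<open>degree r \<le> n\<close> assms(1,2) by (simp add: card_image)
  qed
  \<comment> \<open>The coefficient of order \<open>K\<close> is \<open>b K\<close>: the polynomials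
    of lower index have smaller degree, the one of index \<open>K\<close> is monic, and
    \<open>t\<close> does not reach order \<open>K \<ge> 1\<close>.\<close>
  define K where "K = Max {k \<in> {1..n}. b k \<noteq> 0}"
  have "K \<in> {k \<in> {1..n}. b k \<noteq> 0}"
    unfolding K_def using \<open>b k \<noteq> 0\<close> assms(4) by (intro Max_in) auto
  then have K: "K \<in> {1..n}" "b K \<noteq> 0" by auto
  have above: "b l = 0" if "l \<in> {1..n}" "K < l" for l
  proof (rule ccontr)
    assume "b l \<noteq> 0"
    then have "l \<le> K" unfolding K_def using that by (intro Max_ge) auto
    then show False using that by simp
  qed
  have "coeff r K = (\<Sum>k=1..n. b k * coeff (lower_poly (\<mu> k) x k) K)"
    using K by (cases K) (simp_all add: r_def coeff_sum)
  also have "\<dots> = (\<Sum>k=1..n. if k = K then b K else 0)"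
    by (intro sum.cong refl) (use above in \<open>auto simp: coeff_lower_poly\<close>)
  also have "\<dots> = b K" using K by simp
  finally show False using K \<open>r = 0\<close> by simp
qed

text \<open>All axis vectors but one form a basis; the differences against the omitted index are its
  coordinates.\<close>

lemma cdim_tuple_mod_transl: "cdim (UNIV :: 'm::finite tuple_mod_transl set) = CARD('m) - 1"
proof -
  define o' :: 'm where "o' = undefined"
  let ?f = "\<lambda>i. proj (axis i 1) :: 'm tuple_mod_transl"
  have ind: "\<forall>i\<in>- {o'}. a i = 0" if "(\<Sum>i\<in>- {o'}. a i *\<^sub>C ?f i) = 0" for a
  proof
    fix k assume "k \<in> - {o'}"
    have "coord_diff k o' (\<Sum>i\<in>- {o'}. a i *\<^sub>C ?f i) =
        (\<Sum>i\<in>- {o'}. if i = k then a k else 0)"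
      unfolding covector_sum[OF covector_coord_diff] covector_scale[OF covector_coord_diff]
      by (intro sum.cong refl) (auto simp: axis_def)
    then show "a k = 0"
      using that \<open>k \<in> - {o'}\<close> by (simp add: covector_zero[OF covector_coord_diff])
  qed
  note B = independent_family[where f = ?f, OF finite ind]
  have "v \<in> cspan (?f ` (- {o'}))" for v
  proof -
    have "v = (\<Sum>i\<in>UNIV. coord_diff i o' v *\<^sub>C ?f i)"
      using proj_lambda[of "\<lambda>i. coord_diff i o' v"] by (simp add: proj_coord_diff)
    also have "\<dots> = (\<Sum>i\<in>- {o'}. coord_diff i o' v *\<^sub>C ?f i)"
      by (rule sum.mono_neutral_right) auto
    also have "\<dots> \<in> cspan (?f ` (- {o'}))"
      by (intro cvs.span_sum cvs.span_scale cvs.span_base) auto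
    finally show ?thesis .
  qed
  then have "cdim (UNIV :: 'm tuple_mod_transl set) = card (?f ` (- {o'}))"
    using B(2) by (intro cvs.dim_unique) (auto simp: cindependent_def)
  also have "\<dots> = CARD('m) - 1"
    using card_image[OF B(1)] by (simp add: Compl_eq_Diff_UNIV)
  finally show ?thesis .
qed

section \<open>Potentials and their gradient fields\<close>

context A_weights
begin

text \<open>A linear section of \<open>proj\<close>, zero at an arbitrary fixed index, through which
  the formulas for tuples apply to the quotient.\<close>

definition rep :: "'m tuple_mod_transl \<Rightarrow> 'm \<Rightarrow> complex" where
  "rep v = (\<lambda>i. coord_diff i undefined v)"

definition exponent :: "nat \<Rightarrow> 'm \<Rightarrow> complex" where
  "exponent k = (\<lambda>j. of_nat k * c j / \<sigma>)"

definition potential :: "nat \<Rightarrow> 'm tuple_mod_transl \<Rightarrow> complex" where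
  "potential k v = fps_nth (binom_prod (exponent k) (rep v)) (Suc k)"

text \<open>
  On tuples with \<open>\<Sum>\<^sub>i c\<^sub>i x\<^sub>i = 0\<close> the canonical form is \<open>\<sigma> \<Sum>\<^sub>i c\<^sub>i x\<^sub>i y\<^sub>i\<close>, so the components of the
  gradient are the partial derivatives of the potential divided by \<open>\<sigma> c\<^sub>i\<close>.
\<close>

definition component :: "nat \<Rightarrow> 'm \<Rightarrow> 'm tuple_mod_transl \<Rightarrow> complex" where
  "component k i v = - of_nat k / \<sigma>\<^sup>2 * fps_nth (binom_prod (lower i (exponent k)) (rep v)) k"

definition grad_field :: "nat \<Rightarrow> 'm tuple_mod_transl \<Rightarrow> 'm tuple_mod_transl" where
  "grad_field k v = proj (\<chi> i. component k i v)"

lemma proj_rep: "proj (\<chi> i. rep v i) = v"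
  by (simp add: rep_def proj_coord_diff)

lemma rep_diff: "rep v i - rep v j = coord_diff i j v"
  unfolding rep_def using coord_diff_cocycle[of i j v undefined] by (simp add: algebra_simps)

lemma rep_line: "rep (v + t *\<^sub>C \<xi>) = (\<lambda>j. rep v j + t * rep \<xi> j)"
  by (auto simp: rep_def covector_add[OF covector_coord_diff] covector_scale[OF covector_coord_diff])

lemma polynomial_fun_rep: "polynomial_fun (\<lambda>v. rep v j)"
  by (simp add: rep_def polynomial_fun.covector[OF covector_coord_diff])

lemma sum_exponent: "(\<Sum>j\<in>UNIV. exponent k j) = of_nat k"
  using sum_c_nonzero by (simp add: exponent_def flip: sum_divide_distrib sum_distrib_left)

text \<open>The chosen representative differs from \<open>x\<close> by a translation, which leaves
  the coefficient of order \<open>Suc k\<close> unchanged because the exponents sum to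
  \<open>k\<close>.\<close>

lemma potential_proj:
  assumes "\<And>j. cmod (x $ j) < R"
  shows "potential k (proj x) = pochhammer_integral c k R x"
proof -
  have "rep (proj x) = (\<lambda>j. x $ j + - x $ undefined)"
    by (auto simp: rep_def)
  then show ?thesis
    using binom_prod_translate[OF sum_exponent[of k], of "\<lambda>j. x $ j" "- x $ undefined"]
      pochhammer_integral_eq[of x R c k] assms
    by (simp add: potential_def exponent_def)
qed

text \<open>\<open>binom_prod_euler\<close> at order \<open>k\<close>. It places the components in
  the hyperplane on which the canonical form is diagonal.\<close>

lemma sum_c_component: "(\<Sum>i\<in>UNIV. c i * component k i v) = 0"
proof (cases "k = 0")
  case False
  have "(\<Sum>i\<in>UNIV. c i * component k i v) =
      - 1 / \<sigma> * (\<Sum>i\<in>UNIV. exponent k i * fps_nth (binom_prod (lower i (exponent k)) (rep v)) k)"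
    unfolding sum_distrib_left
    by (intro sum.cong refl) (simp add: component_def exponent_def power2_eq_square)
  then show ?thesis
    by (simp add: binom_prod_euler sum_exponent)
qed (simp add: component_def)

lemma canonical_form_grad_field:
  "canonical_form (A_system c) (grad_field k v) \<eta> =
     - (\<Sum>j\<in>UNIV. exponent k j * rep \<eta> j * fps_nth (binom_prod (lower j (exponent k)) (rep v)) k)"
proof -
  have "canonical_form (A_system c) (grad_field k v) \<eta> = \<sigma> * (\<Sum>i\<in>UNIV. c i * component k i v * rep \<eta> i)"
    unfolding grad_field_def by (subst proj_rep[of \<eta>, symmetric]) (simp add: canonical_form_proj sum_c_component)
  also have "\<dots> = - (\<Sum>j\<in>UNIV. exponent k j * rep \<eta> j * fps_nth (binom_prod (lower j (exponent k)) (rep v)) k)"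
    unfolding sum_distrib_left sum_negf[symmetric]
    by (intro sum.cong refl) (use sum_c_nonzero in \<open>simp add: component_def exponent_def power2_eq_square\<close>)
  finally show ?thesis .
qed

lemma potential_of_grad_field: "potential_of (A_system c) (grad_field k) (potential k)"
  unfolding potential_of_def
proof (intro conjI allI)
  show "polynomial_fun (potential k)"
    unfolding potential_def[abs_def] by (intro polynomial_fun_binom_prod polynomial_fun_rep)
  show "has_dir_deriv (potential k) (canonical_form (A_system c) (grad_field k v) \<eta>) \<eta> v" for v \<eta>
    unfolding has_dir_deriv_def canonical_form_grad_field potential_def rep_line
    using has_field_derivative_binom_prod[of "exponent k" "rep v" "rep \<eta>" k 0] by simp
qed

lemma polynomial_fun_component: "polynomial_fun (component k i)"
  unfolding component_def[abs_def]
  by (intro polynomial_fun.mult polynomial_fun.const polynomial_fun_binom_prod polynomial_fun_rep)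

lemma polynomial_vector_field_grad_field: "polynomial_vector_field (grad_field k)"
  unfolding polynomial_vector_field_def grad_field_def
  by (auto simp: covector_proj intro!: polynomial_fun_sum polynomial_fun.mult polynomial_fun.const
      polynomial_fun_component)

section \<open>The differential system for the gradient fields\<close>

lemma component_diff:
  assumes "i \<noteq> j"
  shows "component (Suc m) i v - component (Suc m) j v = - of_nat (Suc m) / \<sigma>\<^sup>2 *
    (coord_diff i j v * fps_nth (binom_prod (lower j (lower i (exponent (Suc m)))) (rep v)) m)"
  unfolding component_def right_diff_distrib[symmetric] binom_prod_lower_diff[OF assms] rep_diff ..

text \<open>The exponents in \<open>lower i\<close> sum to \<open>m\<close>, so the derivative may
  be taken relative to the base index \<open>i\<close>. This kills the term \<open>j = i\<close>,
  the only one with a changed exponent; in the others \<open>component_diff\<close> supplies the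
  quotient by \<open>coord_diff i j v\<close>.\<close>

lemma has_field_derivative_component:
  assumes "\<And>i j. i \<noteq> j \<Longrightarrow> coord_diff i j v \<noteq> 0"
  shows "((\<lambda>t. component (Suc m) i (v + t *\<^sub>C \<xi>)) has_field_derivative
    (\<Sum>j\<in>UNIV. exponent (Suc m) j * coord_diff i j \<xi> * coord_diff i j (grad_field (Suc m) v) / coord_diff i j v)) (at 0)"
proof -
  let ?\<mu> = "exponent (Suc m)"
  have "(\<Sum>j\<in>UNIV. lower i ?\<mu> j) = of_nat m"
    by (simp add: sum_lower sum_exponent)
  from has_field_derivative_binom_prod_translation_invariant[OF this, of "rep v" "rep \<xi>" i]
  have "((\<lambda>t. component (Suc m) i (v + t *\<^sub>C \<xi>)) has_field_derivative - of_nat (Suc m) / \<sigma>\<^sup>2 *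
      (\<Sum>j\<in>UNIV. lower i ?\<mu> j * (rep \<xi> i - rep \<xi> j) * fps_nth (binom_prod (lower j (lower i ?\<mu>)) (rep v)) m)) (at 0)"
    unfolding component_def rep_line by (rule DERIV_cmult)
  also have "- of_nat (Suc m) / \<sigma>\<^sup>2 *
      (\<Sum>j\<in>UNIV. lower i ?\<mu> j * (rep \<xi> i - rep \<xi> j) * fps_nth (binom_prod (lower j (lower i ?\<mu>)) (rep v)) m) =
      (\<Sum>j\<in>UNIV. ?\<mu> j * coord_diff i j \<xi> * coord_diff i j (grad_field (Suc m) v) / coord_diff i j v)"
    unfolding sum_distrib_left
  proof (rule sum.cong)
    fix j
    show "- of_nat (Suc m) / \<sigma>\<^sup>2 *
        (lower i ?\<mu> j * (rep \<xi> i - rep \<xi> j) * fps_nth (binom_prod (lower j (lower i ?\<mu>)) (rep v)) m) =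
        ?\<mu> j * coord_diff i j \<xi> * coord_diff i j (grad_field (Suc m) v) / coord_diff i j v"
    proof (cases "i = j")
      case False
      have "coord_diff i j (grad_field (Suc m) v) = component (Suc m) i v - component (Suc m) j v"
        by (simp add: grad_field_def)
      moreover have "lower i ?\<mu> j = ?\<mu> j"
        using False by (simp add: lower_def)
      ultimately show ?thesis
        unfolding component_diff[OF False] rep_diff using assms[OF False] by simp
    qed simp
  qed simp
  finally show ?thesis .
qed

lemma edge_nonzero_imp:
  assumes "\<forall>\<alpha>\<in>A_system c. \<alpha> v \<noteq> 0" "i \<noteq> j"
  shows "coord_diff i j v \<noteq> 0"
proof -
  have "coord_diff i j v \<noteq> 0" if "i < j" for i j
    using assms(1) edge_mem[OF that] by (auto simp: edge_def)
  then show ?thesis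
    using assms(2) coord_diff_swap[of i j v] by (cases i j rule: linorder_cases) auto
qed

text \<open>One square root left over from the three edges meets the one in the dual vector, giving
  \<open>c i * c j / \<sigma>\<close>. The factor \<open>1 / c i\<close> inside \<open>pt i\<close>
  and the parameter \<open>k\<close> turn this into \<open>exponent k j\<close>.\<close>

lemma system_rhs_eq:
  "of_nat k *\<^sub>C (\<Sum>\<alpha>\<in>A_system c. (\<alpha> \<xi> * \<alpha> u / \<alpha> v) *\<^sub>C vee (A_system c) \<alpha>) =
    proj (\<chi> i. \<Sum>j\<in>UNIV. exponent k j * coord_diff i j \<xi> * coord_diff i j u / coord_diff i j v)"
proof -
  define w where "w i j = c i * c j / \<sigma> * (coord_diff i j \<xi> * coord_diff i j u / coord_diff i j v)" for i j
  have "(\<Sum>\<alpha>\<in>A_system c. (\<alpha> \<xi> * \<alpha> u / \<alpha> v) *\<^sub>C vee (A_system c) \<alpha>) =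
      (\<Sum>(i, j)\<in>{(i, j). i < j}. w i j *\<^sub>C (pt i - pt j))"
    unfolding sum_A_system
  proof (intro sum.cong refl, clarify)
    fix i j
    have "edge i j \<xi> * edge i j u / edge i j v * (csqrt (c i * c j) / \<sigma>) =
        (csqrt (c i * c j) * csqrt (c i * c j)) / \<sigma> * (coord_diff i j \<xi> * coord_diff i j u / coord_diff i j v)"
      using csqrt_mult_nonzero[of i j] by (simp add: edge_def mult_ac del: csqrt_eq_0 mult_eq_0_iff)
    then show "(edge i j \<xi> * edge i j u / edge i j v) *\<^sub>C vee (A_system c) (edge i j) = w i j *\<^sub>C (pt i - pt j)"
      by (simp add: vee_edge[of i j] w_def csqrt_square scaleC_scaleC)
  qed
  also have "\<dots> = (\<Sum>i\<in>UNIV. (\<Sum>j\<in>UNIV. w i j) *\<^sub>C pt i)"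
  proof (rule sum_less_pairs_pt)
    show "w j i = - w i j" for i j
      by (simp add: w_def coord_diff_swap[of j i])
  qed
  finally have "of_nat k *\<^sub>C (\<Sum>\<alpha>\<in>A_system c. (\<alpha> \<xi> * \<alpha> u / \<alpha> v) *\<^sub>C vee (A_system c) \<alpha>) =
      (\<Sum>i\<in>UNIV. (of_nat k * (\<Sum>j\<in>UNIV. w i j) * (1 / c i)) *\<^sub>C proj (axis i 1))"
    by (simp add: pt_scale cvs.scale_sum_right scaleC_scaleC)
  also have "\<dots> = (\<Sum>i\<in>UNIV. (\<Sum>j\<in>UNIV. exponent k j * coord_diff i j \<xi> * coord_diff i j u / coord_diff i j v)
      *\<^sub>C proj (axis i 1))"
  proof (intro sum.cong refl arg_cong2[where f = scaleC])
    fix i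
    show "of_nat k * (\<Sum>j\<in>UNIV. w i j) * (1 / c i) =
        (\<Sum>j\<in>UNIV. exponent k j * coord_diff i j \<xi> * coord_diff i j u / coord_diff i j v)"
      unfolding sum_distrib_left sum_distrib_right
      by (intro sum.cong refl) (simp add: w_def exponent_def c_nonzero)
  qed
  finally show ?thesis by (simp add: proj_lambda)
qed

lemma solves_system_grad_field:
  assumes "k \<noteq> 0"
  shows "solves_system (A_system c) (of_nat k) (grad_field k)"
  unfolding solves_system_def has_dir_deriv_field_def has_dir_deriv_def
proof (intro allI impI)
  fix \<xi> v and \<phi> :: "'m tuple_mod_transl \<Rightarrow> complex"
  assume "\<forall>\<alpha>\<in>A_system c. \<alpha> v \<noteq> 0" and \<phi>: "covector \<phi>"
  then have nz: "coord_diff i j v \<noteq> 0" if "i \<noteq> j" for i j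
    using edge_nonzero_imp that by blast
  \<comment> \<open>The derivative formula concerns coefficients of positive order.\<close>
  obtain m where k: "k = Suc m" using assms by (cases k) auto
  have grad_field_line: "(\<lambda>t. \<phi> (grad_field k (v + t *\<^sub>C \<xi>))) =
      (\<lambda>t. \<Sum>i\<in>UNIV. component k i (v + t *\<^sub>C \<xi>) * \<phi> (proj (axis i 1)))"
    unfolding grad_field_def covector_proj[OF \<phi>] ..
  show "((\<lambda>t. \<phi> (grad_field k (v + t *\<^sub>C \<xi>))) has_field_derivative
      \<phi> (of_nat k *\<^sub>C (\<Sum>\<alpha>\<in>A_system c. (\<alpha> \<xi> * \<alpha> (grad_field k v) / \<alpha> v) *\<^sub>C vee (A_system c) \<alpha>))) (at 0)"
    unfolding grad_field_line unfolding system_rhs_eq covector_proj[OF \<phi>] k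
    by (intro DERIV_sum DERIV_cmult_right has_field_derivative_component nz)
qed

section \<open>Generic independence and harmonicity\<close>

lemma generically_independent_grad_field:
  assumes "n < CARD('m)"
  shows "generically_independent {1..n} grad_field"
proof -
  \<comment> \<open>Distinct numbers as coordinates give a point at which the product of all
    differences is nonzero.\<close>
  obtain f :: "'m \<Rightarrow> nat" where "inj f"
    using finite_imp_inj_to_nat_seg[of "UNIV :: 'm set"] by auto
  show ?thesis
    unfolding generically_independent_def
  proof (intro exI conjI allI impI)
    let ?p = "\<lambda>v. \<Prod>(i, j)\<in>{(i, j). i < j}. coord_diff i j v"
    show "polynomial_fun ?p"
      unfolding split_def by (intro polynomial_fun_prod polynomial_fun.covector covector_coord_diff)
    show "?p (proj (\<chi> i. of_nat (f i))) \<noteq> 0"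
      using \<open>inj f\<close> by (auto simp: inj_eq)
  next
    fix v :: "'m tuple_mod_transl"
    assume "(\<Prod>(i, j)\<in>{(i, j). i < j}. coord_diff i j v) \<noteq> 0"
    then have less: "coord_diff i j v \<noteq> 0" if "i < j" for i j
      using that by auto
    have inj: "inj (rep v)"
    proof (rule injI)
      fix i j assume "rep v i = rep v j"
      then show "i = j"
        using less[of i j] less[of j i] rep_diff[of v i j] rep_diff[of v j i]
        by (cases i j rule: linorder_cases) auto
    qed
    have "\<forall>k\<in>{1..n}. a k = 0" if "(\<Sum>k\<in>{1..n}. a k *\<^sub>C grad_field k v) = 0" for a
    proof
      fix k assume k: "k \<in> {1..n}"
      have "proj (\<Sum>k\<in>{1..n}. a k *s (\<chi> i. component k i v)) = proj 0"
        using that by (simp add: grad_field_def proj_sum proj_scale proj_zero)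
      then obtain t where t: "\<And>i. (\<Sum>k\<in>{1..n}. a k * component k i v) = t"
        by (auto simp: proj_eq_iff)
      \<comment> \<open>The coefficient includes the scalar from \<open>component\<close>, which is
        nonzero for \<open>k \<ge> 1\<close>.\<close>
      have "a k * (- of_nat k / \<sigma>\<^sup>2) = 0"
        by (rule lower_poly_combination_eq_0[OF inj assms, where \<mu> = exponent and t = t])
           (use t k in \<open>simp_all add: component_def mult.assoc\<close>)
      then show "a k = 0"
        using k sum_c_nonzero by simp
    qed
    from independent_family[OF _ this]
    show "inj_on (\<lambda>k. grad_field k v) {1..n}" "cindependent ((\<lambda>k. grad_field k v) ` {1..n})"
      by auto
  qed
qed

lemma harmonic_with_grad_field: "harmonic_with (A_system c) of_nat grad_field"
proof -
  \<comment> \<open>Both sides are \<open>n * (n + 1)\<close> for \<open>n = CARD('m) - 1\<close>;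
    this is the condition on the sum of the parameters.\<close>
  have "2 * (\<Sum>i=1..CARD('m) - 1. i) = 2 * card (A_system c)"
    unfolding card_A_system using double_gauss_sum_from_Suc_0[of "CARD('m) - 1", where ?'a = nat] by simp
  then have "(\<Sum>i=1..CARD('m) - 1. of_nat i) = (of_nat (card (A_system c)) :: complex)"
    by (simp only: of_nat_sum[symmetric] mult_cancel1) simp
  then show ?thesis
    unfolding harmonic_with_def Let_def cdim_tuple_mod_transl
  proof (intro conjI ballI)
    fix i assume "i \<in> {1..CARD('m) - 1}"
    then have "i \<noteq> 0" by simp
    then show "(of_nat i :: complex) \<noteq> 0" "solves_system (A_system c) (of_nat i) (grad_field i)"
      by (simp_all only: of_nat_eq_0_iff not_False_eq_True solves_system_grad_field)
  next
    show "generically_independent {1..CARD('m) - 1} grad_field"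
      by (rule generically_independent_grad_field) simp
  qed (rule polynomial_vector_field_grad_field)
qed

end

text \<open>The dimension is part of the conclusion so that \<open>{1..n}\<close> is visibly the
  index range inside \<open>harmonic_with\<close>.\<close>

theorem theorem5:
  fixes c :: "'m::{finite,linorder} \<Rightarrow> complex" and n :: nat
  assumes "n \<ge> 1" and "CARD('m) = n + 1"
    and "\<And>i. c i \<noteq> 0" and "(\<Sum>i\<in>UNIV. c i) \<noteq> 0"
  shows "cdim (UNIV :: 'm tuple_mod_transl set) = n \<and>
    harmonic (A_system c) \<and>
    (\<exists>\<psi> F. harmonic_with (A_system c) of_nat \<psi> \<and>
       (\<forall>k\<in>{1..n}. potential_of (A_system c) (\<psi> k) (F k) \<and>
          (\<forall>x R. (\<forall>j. cmod (x $ j) < R) \<longrightarrow> F k (proj x) = pochhammer_integral c k R x)))"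
proof -
  interpret A_weights c
    using assms(3,4) by unfold_locales
  have "cdim (UNIV :: 'm tuple_mod_transl set) = n"
    using assms(2) by (simp add: cdim_tuple_mod_transl)
  moreover have "harmonic (A_system c)"
    unfolding harmonic_def using vee_system_A_system harmonic_with_grad_field by blast
  ultimately show ?thesis
    using harmonic_with_grad_field potential_of_grad_field potential_proj by blast
qed

end
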